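(* Let $C\subseteq\mathbb{F}_{q^2}^n$ (respectively, $C\subseteq\mathbb F_q^n$) be a Hermitian (respectively, Euclidean) dual-containing linear code with $\dim C=\frac{n+k}{2}$ that is a classical $(r,\delta)$-LRC. Then the quantum $(r,\delta)$-LRC $Q'(C)$ has parameters $[[n,k,\geq d(C)]]_q$, and these satisfy \[k+2d(C)+2\left(\left\lceil\frac{n+k}{2r}\right\rceil-1\right)(\delta-1)\leq n+2.\]
   Context: $q$ is a power of a prime $p$; $r\ge1$, $\delta\ge2$ integers. Hermitian product $\mathbf x\cdot_h\mathbf y=\sum_jx_jy_j^q$; dual-containing means $C^{\perp_h}\subseteq C$ (respectively $C^{\perp_e}\subseteq C$); $d(\cdot)$ minimum Hamming distance. For $R\subseteq\{1,\dots,n\}$, $\pi_R(C)=\{(c_j)_{j\in R}:\mathbf c\in C\}$. $C$ is a classical $(r,\delta)$-LRC if for each $i$ there is $J\ni i$ with $|J|\le r+\delta-1$ and $d(\pi_J(C))\ge\delta$. Stabilizer codes: for $\mathbb F_q$-linear $D\subseteq\mathbb F_q^{2n}$ self-orthogonal for $(\mathbf a|\mathbf b)\cdot_s(\mathbf c|\mathbf d)=\mathbf a\cdot\mathbf d-\mathbf b\cdot\mathbf c$, with $\xi=e^{2\pi\iota/p}$, $X(a)|x\rangle=|x+a\rangle$, $Z(b)|x\rangle=\xi^{\mathrm{tr}_{q/p}(bx)}|x\rangle$, $E_{(\mathbf a,\mathbf b)}=\bigotimes_jX(a_j)Z(b_j)$, $Q(D)$ is the common eigenspace $\{v:Ev=\lambda(E)v\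 \forall E\in S\}$, $S$ generated by scalars $\xi^\ell\mathcal I$ and $E_{\mathbf y}$, $\mathbf y\in D$, $\lambda$ a character with $\lambda(\xi\mathcal I)=\xi$. For Hermitian self-orthogonal $B$, $Q(B)$ is defined by $\psi^{-1}(B)$, $\psi(\mathbf a|\mathbf b)=\varsigma\mathbf a+\varsigma^q\mathbf b$ ($\{\varsigma,\varsigma^q\}$ a normal basis of $\mathbb F_{q^2}/\mathbb F_q$); for Euclidean self-orthogonal $B$, $Q(B)=Q(B\times B)$. $Q'(C)=Q(C^{\perp_h})$ (respectively $Q(C^{\perp_e})$). An $[[n,k,\ge d]]_q$ code is a $q^k$-dimensional subspace of $\mathbb C^{q^n}$ detecting all errors $E_{(\mathbf a,\mathbf b)}$ of symplectic weight $\#\{j:(a_j,b_j)\ne(0,0)\}$ less than $d$. Quantum $(r,\delta)$-LRC: let $\Gamma(\rho)=q^{-2}\sum_{a,b}X(a)Z(b)\rho(X(a)Z(b))^\dagger$, $\Gamma^I$ apply $\Gamma$ on qudits in $I$; for $\emptyset\neq I\subsetneq J$, $Q$ is $(I,J)$-locally recoverable if some trace-preserving quantum operation $\mathcal R$ acting only on qudits in $J$ satisfies $\mathcal R\circ\Gamma^I(|\varphi\rangle\langle\varphi|)=|\varphi\rangle\langle\varphi|$ for all $|\varphi\rangle\in Q$; $Q$ is a quantum $(r,\delta)$-LRC if for each $i$ there is $J\ni i$, $|J|\le r+\delta-1$, with $Q$ $(I,J)$-locally recoverable for all $I\subsetneq J$ with $|I|=\delta-1$. *)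

theory Defs
  imports Complex_Main "HOL-Library.Function_Algebras" "HOL-Library.Cardinality"
begin

text \<open>Vectors of length n over a field are functions from a finite index type 'n
  (n = CARD('n)) to the field.\<close>

definition vscale :: "'f::field \<Rightarrow> ('n \<Rightarrow> 'f) \<Rightarrow> ('n \<Rightarrow> 'f)" where
  "vscale c v = (\<lambda>j. c * v j)"

definition linear_code :: "('n::finite \<Rightarrow> 'f::field) set \<Rightarrow> bool" where
  "linear_code C \<longleftrightarrow> module.subspace vscale C"

definition code_dim :: "('n::finite \<Rightarrow> 'f::field) set \<Rightarrow> nat" where
  "code_dim C = vector_space.dim vscale C"

definition hdist :: "('n::finite \<Rightarrow> 'f) \<Rightarrow> ('n \<Rightarrow> 'f) \<Rightarrow> nat" where
  "hdist x y = card {j. x j \<noteq> y j}"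

text \<open>Minimum Hamming distance (convention: 0 if there are no two distinct codewords;
  this never occurs in the situation of the theorem).\<close>
definition mindist :: "('n::finite \<Rightarrow> 'f) set \<Rightarrow> nat" where
  "mindist C = Inf {hdist x y | x y. x \<in> C \<and> y \<in> C \<and> x \<noteq> y}"

text \<open>Projection onto the coordinates in R (other coordinates set to 0; this does not
  change Hamming distances within the projected code).\<close>
definition proj :: "'n set \<Rightarrow> ('n \<Rightarrow> 'f::zero) \<Rightarrow> ('n \<Rightarrow> 'f)" where
  "proj R c = (\<lambda>j. if j \<in> R then c j else 0)"

definition classical_lrc :: "('n::finite \<Rightarrow> 'f::zero) set \<Rightarrow> nat \<Rightarrow> nat \<Rightarrow> bool" where
  "classical_lrc C r \<delta> \<longleftrightarrow>
     (\<forall>i. \<exists>J. i \<in> J \<and> card J \<le> r + \<delta> - 1 \<and> mindist (proj J ` C) \<ge> \<delta>)"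

definition edual :: "('n::finite \<Rightarrow> 'f::field) set \<Rightarrow> ('n \<Rightarrow> 'f) set" where
  "edual C = {y. \<forall>x\<in>C. (\<Sum>j\<in>UNIV. x j * y j) = 0}"

definition hdual :: "nat \<Rightarrow> ('n::finite \<Rightarrow> 'f::field) set \<Rightarrow> ('n \<Rightarrow> 'f) set" where
  "hdual q C = {y. \<forall>x\<in>C. (\<Sum>j\<in>UNIV. x j * y j ^ q) = 0}"

text \<open>States of n qudits over F_q: functions from the computational basis
  F_q^n (= 'n => 'a) to the complex numbers; operators are matrices indexed by the basis.\<close>

type_synonym ('n, 'a) qstate = "('n \<Rightarrow> 'a) \<Rightarrow> complex"
type_synonym ('n, 'a) qop = "('n \<Rightarrow> 'a) \<Rightarrow> ('n \<Rightarrow> 'a) \<Rightarrow> complex"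

definition ext_deg :: "'a::{finite,field} itself \<Rightarrow> nat" where
  "ext_deg (t::'a itself) = (THE m. CARD('a) = CHAR('a) ^ m)"

definition trace_el :: "'a::{finite,field} \<Rightarrow> 'a" where
  "trace_el x = (\<Sum>i<ext_deg TYPE('a). x ^ (CHAR('a) ^ i))"

definition trace_nat :: "'a::{finite,field} \<Rightarrow> nat" where
  "trace_nat x = (THE t. t < CHAR('a) \<and> of_nat t = trace_el x)"

definition xi :: "'a::{finite,field} itself \<Rightarrow> complex" where
  "xi (t::'a itself) = exp (2 * pi * \<i> / of_nat CHAR('a))"

definition XZ1 :: "'a::{finite,field} \<Rightarrow> 'a \<Rightarrow> 'a \<Rightarrow> 'a \<Rightarrow> complex" where
  "XZ1 a b x y = (if x = y + a then xi TYPE('a) ^ trace_nat (b * y) else 0)"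

definition pauli :: "('n::finite \<Rightarrow> 'a::{finite,field}) \<Rightarrow> ('n \<Rightarrow> 'a) \<Rightarrow> ('n, 'a) qop" where
  "pauli a b = (\<lambda>x y. \<Prod>j\<in>UNIV. XZ1 (a j) (b j) (x j) (y j))"

definition swt :: "('n::finite \<Rightarrow> 'a::zero) \<Rightarrow> ('n \<Rightarrow> 'a) \<Rightarrow> nat" where
  "swt a b = card {j. a j \<noteq> 0 \<or> b j \<noteq> 0}"

definition mmul :: "('n::finite, 'a::finite) qop \<Rightarrow> ('n, 'a) qop \<Rightarrow> ('n, 'a) qop" where
  "mmul A B = (\<lambda>x y. \<Sum>z\<in>UNIV. A x z * B z y)"

definition adj :: "('n, 'a) qop \<Rightarrow> ('n, 'a) qop" where
  "adj A = (\<lambda>x y. cnj (A y x))"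

definition app :: "('n::finite, 'a::finite) qop \<Rightarrow> ('n, 'a) qstate \<Rightarrow> ('n, 'a) qstate" where
  "app A v = (\<lambda>x. \<Sum>y\<in>UNIV. A x y * v y)"

definition scalar_op :: "complex \<Rightarrow> ('n, 'a) qop" where
  "scalar_op c = (\<lambda>x y. if x = y then c else 0)"

text \<open>The group S generated by the scalars xi^l I and the E_y, y in D
  (a finite group, so the generated monoid is the generated group).\<close>
inductive_set stab_group :: "(('n::finite \<Rightarrow> 'a::{finite,field}) \<times> ('n \<Rightarrow> 'a)) set \<Rightarrow> ('n, 'a) qop set"
  for D where
  scal: "scalar_op (xi TYPE('a) powi l) \<in> stab_group D"
| gen: "y \<in> D \<Longrightarrow> pauli (fst y) (snd y) \<in> stab_group D"
| mult: "A \<in> stab_group D \<Longrightarrow> B \<in> stab_group D \<Longrightarrow> mmul A B \<in> stab_group D"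

definition stab_char :: "(('n::finite \<Rightarrow> 'a::{finite,field}) \<times> ('n \<Rightarrow> 'a)) set \<Rightarrow> (('n, 'a) qop \<Rightarrow> complex) \<Rightarrow> bool" where
  "stab_char D chr \<longleftrightarrow>
     (\<forall>A\<in>stab_group D. \<forall>B\<in>stab_group D. chr (mmul A B) = chr A * chr B) \<and>
     chr (scalar_op (xi TYPE('a))) = xi TYPE('a)"

definition stab_code :: "(('n::finite \<Rightarrow> 'a::{finite,field}) \<times> ('n \<Rightarrow> 'a)) set \<Rightarrow> (('n, 'a) qop \<Rightarrow> complex) \<Rightarrow> ('n, 'a) qstate set" where
  "stab_code D chr = {v. \<forall>E\<in>stab_group D. app E v = (\<lambda>x. chr E * v x)}"

definition psi_inv :: "('a::{finite,field} \<Rightarrow> 'b::field) \<Rightarrow> 'b \<Rightarrow> ('n \<Rightarrow> 'b) set \<Rightarrow> (('n \<Rightarrow> 'a) \<times> ('n \<Rightarrow> 'a)) set" where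
  "psi_inv emb s B = {(a, b). (\<lambda>j. s * emb (a j) + s ^ CARD('a) * emb (b j)) \<in> B}"

definition field_embedding :: "('a::field \<Rightarrow> 'b::field) \<Rightarrow> bool" where
  "field_embedding emb \<longleftrightarrow> inj emb \<and> emb 1 = 1 \<and>
     (\<forall>x y. emb (x + y) = emb x + emb y) \<and> (\<forall>x y. emb (x * y) = emb x * emb y)"

definition normal_basis_elt :: "('a::{finite,field} \<Rightarrow> 'b::field) \<Rightarrow> 'b \<Rightarrow> bool" where
  "normal_basis_elt emb s \<longleftrightarrow>
     (\<forall>z. \<exists>!uv. z = emb (fst uv) * s + emb (snd uv) * s ^ CARD('a))"

definition cscale :: "complex \<Rightarrow> ('n, 'a) qstate \<Rightarrow> ('n, 'a) qstate" where
  "cscale c v = (\<lambda>x. c * v x)"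

definition cinner :: "('n::finite, 'a::finite) qstate \<Rightarrow> ('n, 'a) qstate \<Rightarrow> complex" where
  "cinner u v = (\<Sum>x\<in>UNIV. cnj (u x) * v x)"

definition detects :: "('n::finite, 'a::finite) qstate set \<Rightarrow> ('n, 'a) qop \<Rightarrow> bool" where
  "detects Q E \<longleftrightarrow> (\<exists>c. \<forall>u\<in>Q. \<forall>v\<in>Q. cinner u (app E v) = c * cinner u v)"

definition qecc :: "('n::finite, 'a::{finite,field}) qstate set \<Rightarrow> nat \<Rightarrow> nat \<Rightarrow> bool" where
  "qecc Q k d \<longleftrightarrow> module.subspace cscale Q \<and>
     vector_space.dim cscale Q = CARD('a) ^ k \<and>
     (\<forall>a b. swt a b < d \<longrightarrow> detects Q (pauli a b))"

definition proj_state :: "('n, 'a) qstate \<Rightarrow> ('n, 'a) qop" where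
  "proj_state \<phi> = (\<lambda>x y. \<phi> x * cnj (\<phi> y))"

definition conj_by :: "('n::finite, 'a::finite) qop \<Rightarrow> ('n, 'a) qop \<Rightarrow> ('n, 'a) qop" where
  "conj_by E \<rho> = mmul (mmul E \<rho>) (adj E)"

text \<open>Gamma^I: the completely depolarizing channel Gamma applied on every qudit of I
  (tensored with the identity on the others), written as the operator sum over Paulis
  supported in I.\<close>
definition Gamma :: "'n set \<Rightarrow> ('n::finite, 'a::{finite,field}) qop \<Rightarrow> ('n, 'a) qop" where
  "Gamma I \<rho> = (\<lambda>x y. (1 / of_nat (CARD('a) ^ (2 * card I))) *
     (\<Sum>ab\<in>{(a, b). \<forall>j. j \<notin> I \<longrightarrow> a j = 0 \<and> b j = 0}.
        conj_by (pauli (fst ab) (snd ab)) \<rho> x y))"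

text \<open>A (Kraus) operator acting only on the qudits in J: B tensor identity.\<close>
definition acts_only_on :: "'n set \<Rightarrow> ('n, 'a::zero) qop \<Rightarrow> bool" where
  "acts_only_on J A \<longleftrightarrow> (\<exists>B. A = (\<lambda>x y. if (\<forall>j. j \<notin> J \<longrightarrow> x j = y j)
                                         then B (proj J x) (proj J y) else 0))"

text \<open>A trace-preserving quantum operation (operator-sum form with Kraus
  operators K 0, ..., K (m-1)) acting only on the qudits in J.\<close>
definition local_tp_operation :: "'n set \<Rightarrow> (nat \<Rightarrow> ('n::finite, 'a::{finite,zero}) qop) \<Rightarrow> nat \<Rightarrow> bool" where
  "local_tp_operation J K m \<longleftrightarrow> (\<forall>i<m. acts_only_on J (K i)) \<and>
     (\<forall>x y. (\<Sum>i<m. mmul (adj (K i)) (K i) x y) = scalar_op 1 x y)"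

definition apply_operation :: "(nat \<Rightarrow> ('n::finite, 'a::finite) qop) \<Rightarrow> nat \<Rightarrow> ('n, 'a) qop \<Rightarrow> ('n, 'a) qop" where
  "apply_operation K m \<rho> = (\<lambda>x y. \<Sum>i<m. conj_by (K i) \<rho> x y)"

definition locally_recoverable :: "('n::finite, 'a::{finite,field}) qstate set \<Rightarrow> 'n set \<Rightarrow> 'n set \<Rightarrow> bool" where
  "locally_recoverable Q I J \<longleftrightarrow>
     (\<exists>K m. local_tp_operation J K m \<and>
        (\<forall>\<phi>\<in>Q. apply_operation K m (Gamma I (proj_state \<phi>)) = proj_state \<phi>))"

definition quantum_lrc :: "('n::finite, 'a::{finite,field}) qstate set \<Rightarrow> nat \<Rightarrow> nat \<Rightarrow> bool" where
  "quantum_lrc Q r \<delta> \<longleftrightarrow>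
     (\<forall>i. \<exists>J. i \<in> J \<and> card J \<le> r + \<delta> - 1 \<and>
        (\<forall>I. I \<subset> J \<and> I \<noteq> {} \<and> card I = \<delta> - 1 \<longrightarrow> locally_recoverable Q I J))"

end

theory Submission
  imports Defs "HOL-Computational_Algebra.Polynomial" "HOL-Number_Theory.Cong" "HOL-Library.Product_Plus"
begin

text \<open>
  Composing the trace with a primitive \<open>p\<close>-th root of unity gives a nontrivial additive character
  \<open>chi\<close> of the field, and every statement below reduces to orthogonality of characters and counting.

  For a subgroup \<open>G\<close> of the stabilizer, averaging \<open>E\<close> divided by its eigenvalue over \<open>G\<close> is an
  orthogonal projection \<open>P\<close>; for the full stabilizer its image is the code and its trace is the
  dimension. If \<open>E\<close> fails to commute with some element of \<open>G\<close>, then \<open>P E P = 0\<close>; this gives error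
  detection. Dual codewords supported in a recovery set \<open>J\<close> form the dual of the projection of \<open>C\<close>
  to \<open>J\<close>, which has minimum distance at least \<open>\<delta>\<close>, so the stabilizers supported in \<open>J\<close> separate
  all errors on \<open>\<delta> - 1\<close> positions of \<open>J\<close>: measuring their syndrome and undoing the error is a
  recovery map acting on \<open>J\<close> only.

  For the bound, adjoin recovery sets to a set \<open>S\<close> of positions one at a time. Each step divides the
  number of codewords vanishing on \<open>S\<close> by at most the number of symbols to the power \<open>r\<close>, and \<open>\<delta> - 1\<close>
  of the new positions impose no condition. A nonzero codeword vanishing on the final set has low weight.
\<close>

section \<open>The canonical additive character of a finite field\<close>

lemma prime_CHAR_finite_field: "prime CHAR('a::{finite,field})"
  by (intro prime_CHAR_semidom finite_imp_CHAR_pos) auto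

text \<open>Multiplication by a nonzero \<open>x\<close> permutes the nonzero elements, so their
  product does not change when multiplied by \<open>x ^ (CARD('a) - 1)\<close>.\<close>

lemma finite_field_power_CARD: "x ^ CARD('a) = (x::'a::{finite,field})"
proof (cases "x = 0")
  case False
  have bij: "bij_betw ((*) x) (UNIV - {0}) (UNIV - {0})"
    by (rule bij_betw_byWitness[where f' = "\<lambda>y. y / x"]) (use False in auto)
  have "x ^ (CARD('a) - 1) * \<Prod>(UNIV - {0}) = (\<Prod>y\<in>UNIV - {0}. x * y)"
    by (simp add: prod.distrib)
  also have "\<dots> = \<Prod>(UNIV - {0})"
    using prod.reindex_bij_betw[OF bij, of "\<lambda>y. y"] by simp
  finally have "x ^ (CARD('a) - 1) = 1"
    by simp
  then have "x ^ Suc (CARD('a) - 1) = x"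
    unfolding power_Suc by simp
  then show ?thesis
    by (simp only: Suc_diff_1[OF zero_less_card_finite])
qed (simp add: card_gt_0_iff)

text \<open>A largest additive subgroup of \<open>p\<close>-power order, with \<open>p\<close> the
  characteristic, must be the whole field: adjoining the multiples of an outside element
  \<open>x\<close> would give one \<open>p\<close> times as large.\<close>

lemma CARD_finite_field_eq_CHAR_power: "\<exists>m. CARD('a::{finite,field}) = CHAR('a) ^ m"
proof -
  let ?p = "CHAR('a)"
  define \<H> where "\<H> = {H :: 'a set. 0 \<in> H \<and> (\<forall>x\<in>H. \<forall>y\<in>H. x - y \<in> H) \<and> (\<exists>m. card H = ?p ^ m)}"
  have "{0} \<in> \<H>"
    by (auto simp: \<H>_def intro!: exI[of _ 0])
  then have "Max (card ` \<H>) \<in> card ` \<H>"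
    by (intro Max_in) auto
  then obtain H where H: "H \<in> \<H>" and "card H = Max (card ` \<H>)"
    by auto
  then have max: "card H' \<le> card H" if "H' \<in> \<H>" for H'
    using that by simp
  have H0: "0 \<in> H" and Hd: "\<And>x y. x \<in> H \<Longrightarrow> y \<in> H \<Longrightarrow> x - y \<in> H"
    using H by (auto simp: \<H>_def)
  have Ha: "x + y \<in> H" if "x \<in> H" "y \<in> H" for x y
    using Hd[OF that(1) Hd[OF H0 that(2)]] by simp
  have Hm: "of_nat n * x \<in> H" if "x \<in> H" for n x
    by (induction n) (use H0 Ha that in \<open>auto simp: algebra_simps\<close>)
  obtain m where m: "card H = ?p ^ m"
    using H by (auto simp: \<H>_def)
  have p: "prime ?p"
    by (rule prime_CHAR_finite_field)
  have "H = UNIV"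
  proof (rule ccontr)
    assume "H \<noteq> UNIV"
    then obtain x where x: "x \<notin> H"
      by auto
    define f where "f = (\<lambda>(t::nat, h). of_nat t * x + h)"
    \<comment> \<open>If \<open>t\<close> were prime to \<open>?p\<close>, multiplying by an inverse
      of \<open>t\<close> modulo \<open>?p\<close> would put \<open>x\<close> itself into
      \<open>H\<close>.\<close>
    have multx: "of_nat t * x \<in> H \<Longrightarrow> ?p dvd t" for t
    proof (rule ccontr)
      assume *: "of_nat t * x \<in> H" "\<not> ?p dvd t"
      then have "coprime t ?p"
        using p by (metis coprime_commute prime_imp_coprime)
      then obtain s where "[t * s = 1] (mod ?p)"
        using cong_solve_coprime_nat by auto
      then have "(of_nat (t * s) :: 'a) = of_nat 1"
        by (simp only: of_nat_eq_iff_cong_CHAR)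
      then have "of_nat s * (of_nat t * x) = x"
        by (metis mult.commute mult.left_commute mult.right_neutral of_nat_1 of_nat_mult)
      then show False
        using Hm[OF *(1), of s] x by metis
    qed
    have "inj_on f ({..<?p} \<times> H)"
    proof (rule inj_onI)
      fix u v assume u: "u \<in> {..<?p} \<times> H" and v: "v \<in> {..<?p} \<times> H" and uv: "f u = f v"
      have *: "t = t'" if "t' \<le> t" "t < ?p" "h \<in> H" "h' \<in> H" "f (t, h) = f (t', h')" for t t' h h'
      proof -
        have "of_nat (t - t') * x = h' - h"
          using that by (simp add: f_def of_nat_diff algebra_simps)
        then have "?p dvd t - t'"
          using multx Hd that by metis
        then have "t - t' = 0"
          using that by (metis dvd_imp_le less_imp_diff_less linorder_not_less not_gr_zero)
        then show ?thesis
          using that by simp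
      qed
      obtain t h t' h' where [simp]: "u = (t, h)" "v = (t', h')"
        by (cases u, cases v)
      have "t = t'"
        using *[of t' t h h'] *[of t t' h' h] u v uv by (cases "t' \<le> t") auto
      then show "u = v"
        using uv by (simp add: f_def)
    qed
    then have cardf: "card (f ` ({..<?p} \<times> H)) = ?p ^ Suc m"
      by (simp add: card_image card_cartesian_product m)
    have mem: "of_nat t * x + h \<in> f ` ({..<?p} \<times> H)" if "h \<in> H" for t h
    proof -
      have "(of_nat t :: 'a) = of_nat (t mod ?p)"
        by (simp add: of_nat_eq_iff_cong_CHAR cong_def)
      moreover have "t mod ?p < ?p"
        using p by (simp add: prime_gt_0_nat)
      ultimately show ?thesis
        using that by (auto simp: f_def intro!: image_eqI[of _ _ "(t mod ?p, h)"])
    qed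
    have "f ` ({..<?p} \<times> H) \<in> \<H>"
      unfolding \<H>_def
    proof (intro CollectI conjI ballI)
      show "0 \<in> f ` ({..<?p} \<times> H)"
        using mem[OF H0, of 0] by simp
      show "\<exists>m. card (f ` ({..<?p} \<times> H)) = ?p ^ m"
        using cardf by blast
      fix u v assume "u \<in> f ` ({..<?p} \<times> H)" "v \<in> f ` ({..<?p} \<times> H)"
      then obtain t h t' h' where *: "t' < ?p" "h \<in> H" "h' \<in> H"
          "u = of_nat t * x + h" "v = of_nat t' * x + h'"
        by (auto simp: f_def)
      \<comment> \<open>The coefficients are natural numbers, so \<open>?p - t'\<close> stands in
        for the negative of \<open>t'\<close>.\<close>
      have "u - v = of_nat (t + (?p - t')) * x + (h - h')"
        using * by (simp add: of_nat_diff algebra_simps)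
      then show "u - v \<in> f ` ({..<?p} \<times> H)"
        by (simp only: mem[OF Hd[OF *(2,3)]])
    qed
    from max[OF this] show False
      using cardf m prime_gt_1_nat[OF p] by simp
  qed
  then show ?thesis
    using m by auto
qed

lemma CARD_eq_CHAR_power_ext_deg: "CARD('a::{finite,field}) = CHAR('a) ^ ext_deg TYPE('a)"
proof -
  obtain m where m: "CARD('a) = CHAR('a) ^ m"
    using CARD_finite_field_eq_CHAR_power by blast
  have "ext_deg TYPE('a) = m"
    unfolding ext_deg_def
    using m prime_gt_1_nat[OF prime_CHAR_finite_field[where 'a = 'a]]
    by (intro the_equality) (auto simp: power_inject_exp)
  then show ?thesis
    using m by simp
qed

text \<open>The polynomial \<open>X ^ p - X\<close> has at most \<open>p\<close> roots, and by
  Fermat's little theorem the images of \<open>0, ..., p - 1\<close> are already \<open>p\<close>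
  distinct ones.\<close>

lemma power_CHAR_eq_self_imp_of_nat:
  fixes t :: "'a::{finite,field}"
  assumes "t ^ CHAR('a) = t"
  shows "\<exists>n<CHAR('a). of_nat n = t"
proof -
  let ?p = "CHAR('a)"
  have p1: "?p > 1"
    by (rule prime_gt_1_nat[OF prime_CHAR_finite_field])
  let ?P = "monom 1 ?p - monom 1 1 :: 'a poly"
  have "coeff ?P ?p = 1"
    using p1 by simp
  then have P0: "?P \<noteq> 0"
    by (metis coeff_0 zero_neq_one)
  have deg: "degree ?P \<le> ?p"
    by (rule degree_diff_le) (use p1 in \<open>auto simp: degree_monom_eq\<close>)
  have fermat: "of_nat n ^ ?p = (of_nat n :: 'a)" for n
  proof (induction n)
    case 0
    then show ?case
      using p1 by (simp add: power_0_left)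
  next
    case (Suc n)
    then show ?case
      by (simp add: freshmans_dream[OF prime_CHAR_finite_field])
  qed
  have "inj_on (of_nat :: nat \<Rightarrow> 'a) {..<?p}"
    by (auto simp: inj_on_def of_nat_eq_iff_cong_CHAR cong_def)
  then have "card (of_nat ` {..<?p} :: 'a set) = ?p"
    by (simp add: card_image)
  moreover have "of_nat ` {..<?p} \<subseteq> {x. poly ?P x = 0}"
    by (auto simp: poly_monom fermat)
  moreover have "card {x. poly ?P x = 0} \<le> ?p"
    using card_poly_roots_bound[OF P0] deg by linarith
  ultimately have "of_nat ` {..<?p} = {x. poly ?P x = 0}"
    by (metis card_seteq finite)
  moreover have "t \<in> {x. poly ?P x = 0}"
    using assms by (simp add: poly_monom)
  ultimately have "t \<in> of_nat ` {..<?p}"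
    by simp
  then show ?thesis
    by auto
qed

section \<open>The trace to the prime field\<close>

lemma trace_el_add: "trace_el (x + y) = trace_el x + trace_el (y::'a::{finite,field})"
  unfolding trace_el_def
  by (simp add: freshmans_dream'[OF prime_CHAR_finite_field refl] sum.distrib)

text \<open>Frobenius shifts the summands cyclically, because the new last term
  \<open>x ^ CARD('a)\<close> is \<open>x\<close> again. Hence the trace lies in the prime field, as
  the definition of \<open>trace_nat\<close> presupposes.\<close>

lemma trace_el_power_CHAR: "trace_el x ^ CHAR('a) = trace_el (x::'a::{finite,field})"
proof -
  let ?p = "CHAR('a)" and ?m = "ext_deg TYPE('a)"
  have "trace_el x ^ ?p = (\<Sum>i<?m. (x ^ (?p ^ i)) ^ ?p)"
    unfolding trace_el_def by (rule freshmans_dream_sum[OF prime_CHAR_finite_field refl])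
  also have "\<dots> = (\<Sum>i<?m. x ^ (?p ^ Suc i))"
    by (simp add: power_mult[symmetric] mult.commute)
  also have "\<dots> = (\<Sum>i<Suc ?m. x ^ (?p ^ i)) - x"
    by (subst sum.lessThan_Suc_shift) simp
  also have "\<dots> = trace_el x"
    using finite_field_power_CARD[of x] by (simp add: trace_el_def CARD_eq_CHAR_power_ext_deg)
  finally show ?thesis .
qed

lemma trace_nat_works:
  "trace_nat x < CHAR('a) \<and> of_nat (trace_nat x) = trace_el (x::'a::{finite,field})"
  unfolding trace_nat_def
proof (rule theI')
  obtain n where "n < CHAR('a)" "of_nat n = trace_el x"
    using power_CHAR_eq_self_imp_of_nat[OF trace_el_power_CHAR] by blast
  then show "\<exists>!t. t < CHAR('a) \<and> of_nat t = trace_el x"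
    by (intro ex1I[of _ n]) (auto simp: of_nat_eq_iff_cong_CHAR cong_def dest: sym)
qed

text \<open>The trace is a polynomial of degree at most \<open>p ^ (m - 1)\<close>, which is less
  than the number of field elements, so it cannot vanish everywhere.\<close>

lemma trace_el_not_identically_zero: "\<exists>x. trace_el x \<noteq> (0::'a::{finite,field})"
proof (rule ccontr)
  assume *: "\<nexists>x. trace_el x \<noteq> (0::'a)"
  let ?p = "CHAR('a)" and ?m = "ext_deg TYPE('a)"
  have p1: "?p > 1"
    by (rule prime_gt_1_nat[OF prime_CHAR_finite_field])
  have "card {0, 1::'a} \<le> CARD('a)"
    by (rule card_mono) auto
  then have m0: "?m > 0"
    using CARD_eq_CHAR_power_ext_deg[where 'a = 'a] by (cases ?m) auto
  define P :: "'a poly" where "P = (\<Sum>i<?m. monom 1 (?p ^ i))"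
  \<comment> \<open>The linear coefficient comes from \<open>i = 0\<close> alone; it shows that the
    polynomial is nonzero.\<close>
  have "coeff P 1 = (\<Sum>i<?m. if i = 0 then 1 else 0)"
    unfolding P_def coeff_sum using p1 by (intro sum.cong) auto
  then have P0: "P \<noteq> 0"
    using m0 by auto
  have "degree P \<le> ?p ^ (?m - 1)"
    unfolding P_def using p1
    by (intro degree_sum_le) (auto simp: degree_monom_eq intro!: power_increasing)
  also have "\<dots> < CARD('a)"
    unfolding CARD_eq_CHAR_power_ext_deg using p1 m0 by (intro power_strict_increasing) auto
  finally have "card {x. poly P x = 0} < CARD('a)"
    using card_poly_roots_bound[OF P0] by linarith
  moreover have "poly P x = trace_el x" for x
    by (simp add: P_def trace_el_def poly_sum poly_monom)
  ultimately show False
    using * by simp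
qed

section \<open>The additive character behind the phases of the error operators\<close>

definition chi :: "'a::{finite,field} \<Rightarrow> complex" where
  "chi x = xi TYPE('a) ^ trace_nat x"

lemma xi_power_eq_cis: "xi TYPE('a::{finite,field}) ^ l = cis (2 * pi * l / CHAR('a))"
proof -
  have "xi TYPE('a) = cis (2 * pi / CHAR('a))"
    by (simp add: xi_def cis_conv_exp mult.commute)
  then show ?thesis
    by (simp add: DeMoivre mult.commute)
qed

lemma xi_neq_0: "xi TYPE('a::{finite,field}) \<noteq> 0"
  by (simp add: xi_def)

lemma norm_xi: "norm (xi TYPE('a::{finite,field})) = 1"
  using xi_power_eq_cis[where 'a = 'a and l = 1] by simp

lemma xi_power_CHAR: "xi TYPE('a::{finite,field}) ^ CHAR('a) = 1"
  using xi_power_eq_cis[where 'a = 'a and l = "CHAR('a)"]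
    prime_gt_0_nat[OF prime_CHAR_finite_field[where 'a = 'a]] by simp

lemma xi_power_mod: "xi TYPE('a::{finite,field}) ^ (n mod CHAR('a)) = xi TYPE('a) ^ n"
proof -
  have "xi TYPE('a) ^ (CHAR('a) * (n div CHAR('a)) + n mod CHAR('a)) = xi TYPE('a) ^ (n mod CHAR('a))"
    unfolding power_add power_mult xi_power_CHAR by simp
  then show ?thesis
    unfolding mult_div_mod_eq by simp
qed

lemma xi_power_neq_1:
  assumes "0 < n" "n < CHAR('a::{finite,field})"
  shows "xi TYPE('a) ^ n \<noteq> 1"
proof
  assume "xi TYPE('a) ^ n = 1"
  then have "cis (2 * pi * n / CHAR('a)) = 1"
    using xi_power_eq_cis[where 'a = 'a and l = n] by simp
  then have "cos (2 * pi * n / CHAR('a)) = 1"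
    by (metis cis.simps(1) one_complex.simps(1))
  then obtain z :: int where "2 * pi * n / CHAR('a) = real_of_int z * 2 * pi"
    using cos_one_2pi_int by blast
  then have "real n = z * CHAR('a)"
    using assms by (simp add: field_simps)
  then have "int n = z * int CHAR('a)"
    by (metis of_int_eq_iff of_int_mult of_int_of_nat_eq)
  then have "CHAR('a) dvd n"
    by (metis dvd_triv_right int_dvd_int_iff)
  then show False
    using assms by (meson dvd_imp_le not_le)
qed

text \<open>\<open>trace_nat\<close> is additive only modulo the characteristic, which suffices
  because the order of \<open>xi\<close> divides it.\<close>

lemma chi_add: "chi (x + y) = chi x * chi y"
proof -
  have "(of_nat (trace_nat (x + y)) :: 'a) = of_nat (trace_nat x + trace_nat y)"
    using trace_nat_works by (metis of_nat_add trace_el_add)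
  then have "trace_nat (x + y) mod CHAR('a) = (trace_nat x + trace_nat y) mod CHAR('a)"
    by (simp only: of_nat_eq_iff_cong_CHAR cong_def)
  then show ?thesis
    unfolding chi_def by (metis power_add xi_power_mod)
qed

lemma chi_neq_0 [simp]: "chi x \<noteq> 0"
  by (simp add: chi_def xi_neq_0)

lemma chi_0 [simp]: "chi 0 = 1"
  using chi_add[of 0 0] by simp

lemma norm_chi [simp]: "norm (chi x) = 1"
  by (simp add: chi_def norm_power norm_xi)

lemma chi_minus: "chi (- x) = inverse (chi x)"
  using chi_add[of x "- x"] by (simp add: inverse_unique)

lemma cnj_chi: "cnj (chi x) = chi (- x)"
  using complex_norm_square[of "chi x"] by (simp add: chi_minus inverse_unique)

lemma chi_nontrivial: "\<exists>x::'a::{finite,field}. chi x \<noteq> 1"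
proof -
  obtain x :: 'a where "trace_el x \<noteq> 0"
    using trace_el_not_identically_zero by blast
  then have "0 < trace_nat x" "trace_nat x < CHAR('a)"
    using trace_nat_works[of x] by (auto intro!: Nat.gr0I)
  then show ?thesis
    unfolding chi_def using xi_power_neq_1 by blast
qed

text \<open>Scaling turns a nonzero value of a form into a phase other than 1; this is how
  non-orthogonality becomes visible to characters.\<close>

lemma chi_mult_nontrivial:
  assumes "y \<noteq> (0::'a::{finite,field})"
  shows "\<exists>c. chi (c * y) \<noteq> 1"
proof -
  obtain x :: 'a where "chi x \<noteq> 1"
    using chi_nontrivial by blast
  then show ?thesis
    using assms by (intro exI[of _ "x / y"]) simp
qed

section \<open>Duality and the Singleton bound for classical codes\<close>

interpretation vscale: vector_space "vscale :: 'f::field \<Rightarrow> ('n \<Rightarrow> 'f) \<Rightarrow> 'n \<Rightarrow> 'f"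
  by unfold_locales (auto simp: vscale_def algebra_simps fun_eq_iff)

lemma linear_code_0: "linear_code C \<Longrightarrow> 0 \<in> C"
  unfolding linear_code_def by (rule vscale.subspace_0)

lemma linear_code_add: "linear_code C \<Longrightarrow> x \<in> C \<Longrightarrow> y \<in> C \<Longrightarrow> x + y \<in> C"
  unfolding linear_code_def by (rule vscale.subspace_add)

lemma linear_code_diff: "linear_code C \<Longrightarrow> x \<in> C \<Longrightarrow> y \<in> C \<Longrightarrow> x - y \<in> C"
  unfolding linear_code_def by (rule vscale.subspace_diff)

lemma linear_code_vscale: "linear_code C \<Longrightarrow> x \<in> C \<Longrightarrow> vscale c x \<in> C"
  unfolding linear_code_def by (rule vscale.subspace_scale)

lemma linear_codeI:
  assumes "0 \<in> C" "\<And>x y. x \<in> C \<Longrightarrow> y \<in> C \<Longrightarrow> x + y \<in> C" "\<And>c x. x \<in> C \<Longrightarrow> vscale c x \<in> C"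
  shows "linear_code C"
  unfolding linear_code_def vscale.subspace_def using assms by simp

text \<open>Each further independent vector \<open>b\<close> multiplies the size by
  \<open>CARD('a)\<close>: the elements of the larger span are uniquely \<open>scale k b + y\<close>
  with \<open>y\<close> in the smaller one.\<close>

lemma (in vector_space) card_span_independent:
  assumes "finite B" "independent B"
  shows "card (span B) = CARD('a) ^ card B"
  using assms
proof (induction B)
  case (insert b B)
  have b: "b \<notin> span B" and B: "independent B"
    using insert by (auto simp: independent_insert)
  have "bij_betw (\<lambda>(k, y). scale k b + y) (UNIV \<times> span B) (span (insert b B))"
    unfolding bij_betw_def
  proof
    show "inj_on (\<lambda>(k, y). scale k b + y) (UNIV \<times> span B)"
    proof (rule inj_onI, clarify)
      fix k y k' y' assume y: "y \<in> span B" "y' \<in> span B" "scale k b + y = scale k' b + y'"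
      then have "scale (k - k') b = y' - y"
        by (simp add: scale_left_diff_distrib algebra_simps)
      then have "scale (k - k') b \<in> span B"
        using y by (simp add: span_diff)
      then have "scale (inverse (k - k')) (scale (k - k') b) \<in> span B"
        by (rule span_scale)
      then have "k = k'"
        using b by (cases "k = k'") auto
      then show "k = k' \<and> y = y'"
        using y by simp
    qed
    show "(\<lambda>(k, y). scale k b + y) ` (UNIV \<times> span B) = span (insert b B)"
    proof (intro equalityI subsetI)
      fix x assume "x \<in> span (insert b B)"
      then obtain k where "x - scale k b \<in> span B"
        by (auto simp: span_insert)
      then show "x \<in> (\<lambda>(k, y). scale k b + y) ` (UNIV \<times> span B)"
        by (intro image_eqI[of _ _ "(k, x - scale k b)"]) auto
    next
      fix x assume "x \<in> (\<lambda>(k, y). scale k b + y) ` (UNIV \<times> span B)"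
      then obtain k y where "x = scale k b + y" "y \<in> span B"
        by auto
      then show "x \<in> span (insert b B)"
        by (auto simp: span_insert intro!: exI[of _ k])
    qed
  qed
  then have "card (span (insert b B)) = CARD('a) * card (span B)"
    by (metis bij_betw_same_card card_cartesian_product)
  then show ?case
    using insert B by simp
qed simp

lemma card_linear_code:
  fixes C :: "('n::finite \<Rightarrow> 'f::{finite,field}) set"
  assumes "linear_code C"
  shows "card C = CARD('f) ^ code_dim C"
proof -
  obtain B where B: "B \<subseteq> C" "vscale.independent B" "C \<subseteq> vscale.span B" "card B = code_dim C"
    unfolding code_dim_def using vscale.basis_exists by blast
  then have "vscale.span B = C"
    using assms vscale.span_minimal unfolding linear_code_def by blast
  then show ?thesis
    using vscale.card_span_independent[OF finite B(2)] B(4) by simp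
qed

section \<open>The standard bilinear form and dual codes\<close>

definition ip :: "('n::finite \<Rightarrow> 'f::comm_ring_1) \<Rightarrow> ('n \<Rightarrow> 'f) \<Rightarrow> 'f" where
  "ip x y = (\<Sum>j\<in>UNIV. x j * y j)"

lemma ip_add_left: "ip (x + y) z = ip x z + ip y z"
  and ip_add_right: "ip z (x + y) = ip z x + ip z y"
  and ip_diff_right: "ip z (x - y) = ip z x - ip z y"
  and ip_minus_left: "ip (- x) z = - ip x z"
  and ip_minus_right: "ip z (- x) = - ip z x"
  by (simp_all add: ip_def algebra_simps sum.distrib sum_subtractf sum_negf)

lemma ip_0_left [simp]: "ip 0 z = 0"
  and ip_0_right [simp]: "ip z 0 = 0"
  by (simp_all add: ip_def)

lemma ip_vscale_left: "ip (vscale c x) y = c * ip x y"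
  and ip_vscale_right: "ip x (vscale c y) = c * ip x y"
  by (simp_all add: ip_def vscale_def sum_distrib_left algebra_simps)

lemma ip_commute: "ip x y = ip y x"
  by (simp add: ip_def mult.commute)

lemma ip_nonzero_left: "x \<noteq> 0 \<Longrightarrow> \<exists>y. ip x y \<noteq> (0::'f::field)"
proof -
  assume "x \<noteq> 0"
  then obtain j where j: "x j \<noteq> 0"
    by (auto simp: fun_eq_iff)
  have "ip x (\<lambda>i. if i = j then 1 else 0) = x j"
    by (simp add: ip_def if_distrib cong: if_cong)
  then show ?thesis
    using j by metis
qed

lemma edual_ip: "edual C = {y. \<forall>x\<in>C. ip x y = 0}"
  by (simp add: edual_def ip_def)

lemma linear_code_edual: "linear_code (edual C)"
  by (rule linear_codeI) (auto simp: edual_ip ip_add_right ip_vscale_right)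

text \<open>Translation by \<open>g\<close> permutes \<open>G\<close> and multiplies the sum by
  \<open>f g\<close>, which is not 1.\<close>

lemma sum_nontrivial_character:
  fixes f :: "'g::ab_group_add \<Rightarrow> complex"
  assumes diff: "\<And>x y. x \<in> G \<Longrightarrow> y \<in> G \<Longrightarrow> x - y \<in> G"
    and hom: "\<And>x y. x \<in> G \<Longrightarrow> y \<in> G \<Longrightarrow> f (x + y) = f x * f y"
    and g: "g \<in> G" "f g \<noteq> 1"
  shows "sum f G = 0"
proof -
  have minus: "- x \<in> G" if "x \<in> G" for x
    using diff[OF diff[OF that that] that] by simp
  have "bij_betw ((+) g) G G"
  proof (rule bij_betw_byWitness[where f' = "\<lambda>x. x - g"])
    show "(+) g ` G \<subseteq> G"
      using diff[OF g(1) minus] by auto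
  qed (use diff g in auto)
  then have "sum f G = (\<Sum>x\<in>G. f (g + x))"
    by (simp add: sum.reindex_bij_betw)
  also have "\<dots> = f g * sum f G"
    using g by (simp add: hom sum_distrib_left)
  finally show ?thesis
    using g by simp
qed

lemma sum_chi_ip_UNIV:
  fixes x :: "'n::finite \<Rightarrow> 'f::{finite,field}"
  assumes "x \<noteq> 0"
  shows "(\<Sum>y\<in>UNIV. chi (ip x y)) = 0"
proof -
  obtain y where "ip x y \<noteq> 0"
    using ip_nonzero_left[OF assms] by blast
  then obtain c where "chi (c * ip x y) \<noteq> 1"
    using chi_mult_nontrivial by blast
  then show ?thesis
    by (intro sum_nontrivial_character[where g = "vscale c y"])
       (auto simp: ip_add_right chi_add ip_vscale_right)
qed

text \<open>The sum of \<open>chi (ip x y)\<close> over \<open>x\<close> in \<open>C\<close> and all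
  \<open>y\<close> is evaluated in both orders: summing over \<open>x\<close> first leaves the dual,
  summing over \<open>y\<close> first leaves \<open>x = 0\<close>.\<close>

lemma card_code_times_edual:
  fixes C :: "('n::finite \<Rightarrow> 'f::{finite,field}) set"
  assumes C: "linear_code C"
  shows "card C * card (edual C) = CARD('f) ^ CARD('n)"
proof -
  have inner: "(\<Sum>x\<in>C. chi (ip x y)) = (if y \<in> edual C then of_nat (card C) else 0)" for y
  proof (cases "y \<in> edual C")
    case False
    then obtain x where x: "x \<in> C" "ip x y \<noteq> 0"
      by (auto simp: edual_ip)
    then obtain c where "chi (c * ip x y) \<noteq> 1"
      using chi_mult_nontrivial by blast
    then have "(\<Sum>x\<in>C. chi (ip x y)) = 0"
      using C x by (intro sum_nontrivial_character[where g = "vscale c x"])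
        (auto simp: ip_add_left chi_add ip_vscale_left linear_code_diff linear_code_vscale)
    then show ?thesis
      using False by simp
  qed (simp add: edual_ip)
  have "of_nat (card C * card (edual C)) = (\<Sum>y\<in>UNIV. \<Sum>x\<in>C. chi (ip x y))"
    by (simp add: inner sum.If_cases)
  also have "\<dots> = (\<Sum>x\<in>C. \<Sum>y\<in>UNIV. chi (ip x y))"
    by (rule sum.swap)
  also have "\<dots> = (\<Sum>x\<in>C. if x = 0 then of_nat CARD('n \<Rightarrow> 'f) else 0)"
    by (intro sum.cong) (auto simp: sum_chi_ip_UNIV)
  also have "\<dots> = of_nat CARD('n \<Rightarrow> 'f)"
    using linear_code_0[OF C] by simp
  finally have "card C * card (edual C) = CARD('n \<Rightarrow> 'f)"
    by (simp only: of_nat_eq_iff)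
  then show ?thesis
    by (simp add: card_fun)
qed

text \<open>One inclusion is immediate, and the product formula for \<open>C\<close> and for its
  dual makes the sizes equal.\<close>

lemma edual_edual:
  fixes C :: "('n::finite \<Rightarrow> 'f::{finite,field}) set"
  assumes C: "linear_code C"
  shows "edual (edual C) = C"
proof -
  have "C \<subseteq> edual (edual C)"
    by (auto simp: edual_ip ip_commute)
  moreover have "card C * card (edual C) = card (edual (edual C)) * card (edual C)"
    using card_code_times_edual[OF C] card_code_times_edual[OF linear_code_edual, of C]
    by (simp add: mult.commute)
  moreover have "card (edual C) > 0"
    using linear_code_0[OF linear_code_edual] by (auto simp: card_gt_0_iff)
  ultimately show ?thesis
    by (metis card_subset_eq finite mult_right_cancel not_gr_zero)
qed

section \<open>Supports and projections\<close>

definition supp :: "('n \<Rightarrow> 'f::zero) \<Rightarrow> 'n set" where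
  "supp x = {j. x j \<noteq> 0}"

lemma supp_eq_empty_iff [simp]: "supp x = {} \<longleftrightarrow> x = 0"
  by (auto simp: supp_def fun_eq_iff)

lemma proj_eq_iff: "proj J x = x \<longleftrightarrow> supp x \<subseteq> J"
  by (auto simp: proj_def supp_def fun_eq_iff)

lemma supp_proj: "supp (proj J x) = supp x \<inter> J"
  by (auto simp: proj_def supp_def)

lemma ip_proj: "ip (proj J x) y = ip x (proj J y)"
  by (auto simp: ip_def proj_def intro!: sum.cong)

lemma linear_code_proj:
  assumes "linear_code C"
  shows "linear_code (proj J ` C)"
proof (rule linear_codeI)
  show "0 \<in> proj J ` C"
    by (rule image_eqI[of _ _ 0]) (auto simp: linear_code_0[OF assms] proj_def)
next
  fix x y assume "x \<in> proj J ` C" "y \<in> proj J ` C"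
  then obtain x' y' where "x' \<in> C" "y' \<in> C" "x = proj J x'" "y = proj J y'"
    by blast
  then show "x + y \<in> proj J ` C"
    by (intro image_eqI[of _ _ "x' + y'"]) (auto simp: linear_code_add[OF assms] proj_def fun_eq_iff)
next
  fix c x assume "x \<in> proj J ` C"
  then obtain x' where "x' \<in> C" "x = proj J x'"
    by blast
  then show "vscale c x \<in> proj J ` C"
    by (intro image_eqI[of _ _ "vscale c x'"]) (use linear_code_vscale[OF assms] in \<open>auto simp: proj_def vscale_def\<close>)
qed

lemma mindist_le_card_supp:
  assumes "linear_code C" "x \<in> C" "x \<noteq> 0"
  shows "mindist C \<le> card (supp x)"
  unfolding mindist_def
proof (rule wellorder_Inf_le1)
  show "card (supp x) \<in> {hdist x y |x y. x \<in> C \<and> y \<in> C \<and> x \<noteq> y}"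
    unfolding mem_Collect_eq using assms linear_code_0[OF assms(1)]
    by (intro exI[of _ x] exI[of _ 0]) (simp add: hdist_def supp_def)
qed

text \<open>The subcode of the dual supported in \<open>J\<close> is the dual of the projection to \<open>J\<close>, so every
  vector outside the projection is detected by a dual codeword supported in \<open>J\<close>.\<close>

lemma low_weight_not_orthogonal_to_local_dual:
  fixes C :: "('n::finite \<Rightarrow> 'f::{finite,field}) set"
  assumes C: "linear_code C" and x: "x \<noteq> 0" "supp x \<subseteq> J" "card (supp x) < mindist (proj J ` C)"
  shows "\<exists>z\<in>edual C. supp z \<subseteq> J \<and> ip x z \<noteq> 0"
proof -
  have "x \<notin> proj J ` C"
    using mindist_le_card_supp[OF linear_code_proj[OF C], of x] x by fastforce
  then have "x \<notin> edual (edual (proj J ` C))"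
    by (simp add: edual_edual[OF linear_code_proj[OF C]])
  then obtain z where z: "z \<in> edual (proj J ` C)" "ip z x \<noteq> 0"
    by (auto simp: edual_ip)
  have "ip x (proj J z) \<noteq> 0"
    using z(2) x(2) by (metis ip_commute ip_proj proj_eq_iff)
  moreover have "proj J z \<in> edual C"
    using z(1) by (auto simp: edual_ip ip_proj)
  ultimately show ?thesis
    by (intro bexI[of _ "proj J z"]) (auto simp: supp_proj)
qed

section \<open>Codewords vanishing on prescribed positions\<close>

definition vanishing :: "('n \<Rightarrow> 'f::zero) set \<Rightarrow> 'n set \<Rightarrow> ('n \<Rightarrow> 'f) set" where
  "vanishing C S = {c \<in> C. \<forall>j\<in>S. c j = 0}"

text \<open>The codewords vanishing on \<open>S\<close> are sorted by their value at
  \<open>i\<close>. Subtracting a fixed member maps each nonempty class injectively into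
  \<open>vanishing C (insert i S)\<close>.\<close>

lemma card_vanishing_insert:
  fixes C :: "('n::finite \<Rightarrow> 'f::{finite,field}) set"
  assumes C: "linear_code C"
  shows "card (vanishing C S) \<le> CARD('f) * card (vanishing C (insert i S))"
proof -
  have "card {c \<in> vanishing C S. c i = a} \<le> card (vanishing C (insert i S))" for a
  proof (cases "{c \<in> vanishing C S. c i = a} = {}")
    case False
    then obtain c0 where c0: "c0 \<in> vanishing C S" "c0 i = a"
      by blast
    have "(\<lambda>c. c - c0) ` {c \<in> vanishing C S. c i = a} \<subseteq> vanishing C (insert i S)"
      using c0 linear_code_diff[OF C] by (auto simp: vanishing_def)
    then have "card ((\<lambda>c. c - c0) ` {c \<in> vanishing C S. c i = a}) \<le> card (vanishing C (insert i S))"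
      by (intro card_mono) auto
    then show ?thesis
      by (simp add: card_image inj_on_def)
  next
    case True
    then show ?thesis
      by (simp only: card.empty)
  qed
  then have "(\<Sum>a\<in>UNIV. card {c \<in> vanishing C S. c i = a}) \<le> (\<Sum>a\<in>(UNIV::'f set). card (vanishing C (insert i S)))"
    by (rule sum_mono)
  moreover have "card (vanishing C S) = card (\<Union>a\<in>UNIV. {c \<in> vanishing C S. c i = a})"
    by (rule arg_cong[where f = card]) auto
  moreover have "\<dots> = (\<Sum>a\<in>UNIV. card {c \<in> vanishing C S. c i = a})"
    by (rule card_UN_disjoint) auto
  ultimately show ?thesis
    by simp
qed

lemma card_vanishing_Un:
  fixes C :: "('n::finite \<Rightarrow> 'f::{finite,field}) set"
  assumes C: "linear_code C"
  shows "card (vanishing C S) \<le> CARD('f) ^ card (T - S) * card (vanishing C (S \<union> T))"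
proof -
  have *: "card (vanishing C S) \<le> CARD('f) ^ card U * card (vanishing C (S \<union> U))" for U
  proof (induction U rule: finite_induct[OF finite])
    case (2 i U)
    note 2(3)
    also have "CARD('f) ^ card U * card (vanishing C (S \<union> U))
        \<le> CARD('f) ^ card U * (CARD('f) * card (vanishing C (insert i (S \<union> U))))"
      by (intro mult_left_mono card_vanishing_insert[OF C]) simp
    finally show ?case
      using 2 by (simp add: ac_simps)
  qed simp
  have "S \<union> T = S \<union> (T - S)"
    by auto
  then show ?thesis
    using *[of "T - S"] by simp
qed

text \<open>Adjoining all remaining positions to \<open>S\<close> leaves at most the zero
  word.\<close>

lemma card_vanishing_le:
  fixes C :: "('n::finite \<Rightarrow> 'f::{finite,field}) set"
  assumes "linear_code C"
  shows "card (vanishing C S) * CARD('f) ^ card S \<le> CARD('f) ^ CARD('n)"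
proof -
  have "vanishing C (S \<union> UNIV) \<subseteq> {0}"
    by (auto simp: vanishing_def)
  then have "card (vanishing C (S \<union> UNIV)) \<le> 1"
    using card_mono[of "{0}"] by simp
  then have "CARD('f) ^ card (UNIV - S) * card (vanishing C (S \<union> UNIV)) \<le> CARD('f) ^ card (UNIV - S) * 1"
    by (rule mult_le_mono2)
  then have "card (vanishing C S) \<le> CARD('f) ^ card (UNIV - S)"
    using card_vanishing_Un[OF assms, of S UNIV] by linarith
  moreover have "CARD('n) = card (UNIV - S) + card S"
    by (metis card_Diff_subset card_mono finite le_add_diff_inverse2 subset_UNIV)
  ultimately show ?thesis
    by (simp add: power_add)
qed

text \<open>Any \<open>\<delta> - 1\<close> positions of a recovery set are determined by the remaining ones.\<close>

lemma vanishing_recovery_set: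
  fixes C :: "('n::finite \<Rightarrow> 'f::{finite,field}) set"
  assumes C: "linear_code C" and J: "mindist (proj J ` C) \<ge> \<delta>" and U: "card (J - U) < \<delta>"
  shows "vanishing C (U \<union> J) = vanishing C U"
proof -
  have "c j = 0" if c: "c \<in> vanishing C U" and j: "j \<in> J" for c j
  proof (rule ccontr)
    assume "c j \<noteq> 0"
    then have "proj J c \<noteq> 0"
      using j by (auto simp: proj_def fun_eq_iff)
    moreover have "proj J c \<in> proj J ` C"
      using c by (auto simp: vanishing_def)
    ultimately have "\<delta> \<le> card (supp (proj J c))"
      using mindist_le_card_supp[OF linear_code_proj[OF C]] J le_trans by blast
    also have "\<dots> \<le> card (J - U)"
      using c by (intro card_mono) (auto simp: supp_def proj_def vanishing_def split: if_splits)
    finally show False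
      using U by simp
  qed
  then show ?thesis
    by (auto simp: vanishing_def)
qed

text \<open>Because \<open>m * r\<close> is below \<open>code_dim C\<close>, nonzero words survive
  the adjunction of \<open>m\<close> recovery sets. Padding the set, where necessary, to
  \<open>code_dim C + m * (\<delta> - 1) - 1\<close> positions still leaves a nonzero word, and its
  support avoids all of them.\<close>

lemma lrc_singleton_bound:
  fixes C :: "('n::finite \<Rightarrow> 'f::{finite,field}) set"
  assumes C: "linear_code C" and lrc: "classical_lrc C r \<delta>" and \<delta>: "\<delta> \<ge> 2"
    and m: "m * r < code_dim C"
  shows "code_dim C + mindist C + m * (\<delta> - 1) \<le> CARD('n) + 1"
proof -
  let ?q = "CARD('f)" and ?K = "code_dim C" and ?V = "vanishing C"
  have "card {0, 1::'f} \<le> ?q"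
    by (rule card_mono) auto
  then have q: "?q > 1"
    by simp
  have nonzero: "\<exists>c\<in>?V S. c \<noteq> 0" if "card (?V S) > 1" for S
  proof (rule ccontr)
    assume "\<not> ?thesis"
    then have "?V S \<subseteq> {0}"
      by blast
    then have "card (?V S) \<le> 1"
      using card_mono[of "{0}"] by simp
    then show False
      using that by simp
  qed
  \<comment> \<open>The first estimate says that the recovery sets cost at most \<open>r\<close>
    dimensions each, so nonzero words survive. The second says that
    \<open>m * (\<delta> - 1)\<close> of the positions in \<open>S\<close> cost nothing.\<close>
  have "\<exists>S. ?q ^ ?K \<le> card (?V S) * ?q ^ (m * r) \<and> ?q ^ (?K + m * (\<delta> - 1)) \<le> card (?V S) * ?q ^ card S"
    using m
  proof (induction m)
    case 0
    then show ?case
      using card_linear_code[OF C] by (intro exI[of _ "{}"]) (simp add: vanishing_def)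
  next
    case (Suc m)
    then obtain S where S1: "?q ^ ?K \<le> card (?V S) * ?q ^ (m * r)"
      and S2: "?q ^ (?K + m * (\<delta> - 1)) \<le> card (?V S) * ?q ^ card S"
      by auto
    have "?q ^ (m * r) < ?q ^ ?K"
      using q Suc.prems by (intro power_strict_increasing) auto
    then have "card (?V S) > 1"
      using S1 by (cases "card (?V S)") (auto intro!: Nat.gr0I)
    then obtain c where "c \<in> ?V S" "c \<noteq> 0"
      using nonzero by blast
    \<comment> \<open>Since a surviving word is nonzero at \<open>i\<close>, the recovery set of
      \<open>i\<close> has at least \<open>\<delta>\<close> positions outside \<open>S\<close>: with
      fewer, vanishing on \<open>S\<close> would force a zero at \<open>i\<close>.\<close>
    then obtain i where c: "c \<in> ?V S" "c i \<noteq> 0"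
      by (auto simp: fun_eq_iff)
    obtain J where J: "i \<in> J" "card J \<le> r + \<delta> - 1" "mindist (proj J ` C) \<ge> \<delta>"
      using lrc unfolding classical_lrc_def by blast
    have "\<not> card (J - S) < \<delta>"
    proof
      assume "card (J - S) < \<delta>"
      then have "c \<in> ?V (S \<union> J)"
        using vanishing_recovery_set[OF C J(3)] c by blast
      then show False
        using c J by (auto simp: vanishing_def)
    qed
    \<comment> \<open>\<open>T\<close> consists of the free positions: zeros on \<open>S\<close> and
      on \<open>J - T\<close> force zeros on all of \<open>J\<close>.\<close>
    then obtain T where T: "T \<subseteq> J - S" "card T = \<delta> - 1"
      using obtain_subset_with_card_n[of "\<delta> - 1" "J - S"]
      by (metis diff_le_self le_trans linorder_not_less)
    let ?U = "S \<union> (J - T)"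
    have "?V (?U \<union> J) = ?V ?U"
    proof (rule vanishing_recovery_set[OF C J(3)])
      have "J - ?U \<subseteq> T"
        by auto
      then have "card (J - ?U) \<le> card T"
        by (rule card_mono[OF finite])
      then show "card (J - ?U) < \<delta>"
        using T \<delta> by simp
    qed
    moreover have "?U \<union> J = S \<union> J"
      by auto
    ultimately have V: "?V (S \<union> J) = ?V ?U"
      by simp
    have "(J - T) - S = (J - S) - T"
      by auto
    then have cardU: "card ((J - T) - S) = card (J - S) - (\<delta> - 1)"
      using T by (simp add: card_Diff_subset)
    have "card (J - S) \<le> card J"
      by (intro card_mono) auto
    then have cardr: "card ((J - T) - S) \<le> r"
      using cardU J(2) \<delta> by linarith
    have step: "card (?V S) \<le> ?q ^ card ((J - T) - S) * card (?V (S \<union> J))"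
      using card_vanishing_Un[OF C, of S "J - T"] V by simp
    show ?case
    proof (intro exI[of _ "S \<union> J"] conjI)
      have "?q ^ ?K \<le> card (?V S) * ?q ^ (m * r)"
        by (rule S1)
      also have "\<dots> \<le> (?q ^ r * card (?V (S \<union> J))) * ?q ^ (m * r)"
        using step cardr q
        by (intro mult_right_mono) (auto intro: le_trans[OF _ mult_right_mono] power_increasing)
      finally show "?q ^ ?K \<le> card (?V (S \<union> J)) * ?q ^ (Suc m * r)"
        by (simp add: power_add ac_simps)
    next
      have card: "card (S \<union> J) = card S + card ((J - T) - S) + (\<delta> - 1)"
      proof -
        have "card (S \<union> J) = card S + card (J - S)"
          using card_Un_disjoint[of S "J - S"] by simp
        moreover have "\<delta> - 1 \<le> card (J - S)"
          using T card_mono[of "J - S" T] by simp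
        ultimately show ?thesis
          using cardU by simp
      qed
      have "?q ^ (?K + Suc m * (\<delta> - 1)) = ?q ^ (?K + m * (\<delta> - 1)) * ?q ^ (\<delta> - 1)"
        by (simp add: power_add ac_simps)
      also have "\<dots> \<le> (card (?V S) * ?q ^ card S) * ?q ^ (\<delta> - 1)"
        by (intro mult_right_mono S2) simp
      also have "\<dots> \<le> ((?q ^ card ((J - T) - S) * card (?V (S \<union> J))) * ?q ^ card S) * ?q ^ (\<delta> - 1)"
        by (intro mult_right_mono step) auto
      also have "\<dots> = card (?V (S \<union> J)) * ?q ^ card (S \<union> J)"
        unfolding card by (simp add: power_add ac_simps)
      finally show "?q ^ (?K + Suc m * (\<delta> - 1)) \<le> card (?V (S \<union> J)) * ?q ^ card (S \<union> J)" .
    qed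
  qed
  then obtain S where S1: "?q ^ ?K \<le> card (?V S) * ?q ^ (m * r)"
    and S2: "?q ^ (?K + m * (\<delta> - 1)) \<le> card (?V S) * ?q ^ card S"
    by blast
  \<comment> \<open>One less than the exponent in the second estimate, so that a factor
    \<open>?q\<close> of words remains on \<open>?N\<close> positions.\<close>
  let ?N = "?K + m * (\<delta> - 1) - 1"
  have K: "?K > 0"
    using m by linarith
  have N1: "?N + 1 = ?K + m * (\<delta> - 1)"
    using K by simp
  have "?q ^ (m * r) < ?q ^ ?K"
    using q m by (intro power_strict_increasing) auto
  then have VS: "card (?V S) > 1"
    using S1 by (cases "card (?V S)") (auto intro!: Nat.gr0I)
  have "?q ^ (?K + m * (\<delta> - 1)) \<le> ?q ^ CARD('n)"
    using S2 card_vanishing_le[OF C] le_trans by blast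
  then have N: "?N + 1 \<le> CARD('n)"
    using q K by (simp add: power_increasing_iff)
  \<comment> \<open>If \<open>S\<close> is large enough, the first estimate supplies a nonzero word.
    Otherwise \<open>S\<close> is padded with arbitrary positions and the second estimate leaves at
    least \<open>?q\<close> words.\<close>
  have "\<exists>U. card (?V U) > 1 \<and> ?N \<le> card U"
  proof (cases "?N \<le> card S")
    case False
    then obtain U where U: "S \<subseteq> U" "card U = ?N"
      using N exists_subset_between[of S ?N UNIV] by auto
    have "?q ^ (?N + 1) \<le> card (?V S) * ?q ^ card S"
      using S2 unfolding N1 .
    also have "\<dots> \<le> (?q ^ card (U - S) * card (?V (S \<union> U))) * ?q ^ card S"
      by (intro mult_right_mono card_vanishing_Un[OF C]) simp
    also have "\<dots> = card (?V U) * ?q ^ (card (U - S) + card S)"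
      using U by (simp add: power_add Un_absorb1)
    also have "card (U - S) + card S = ?N"
      using U by (metis card_Diff_subset card_mono finite le_add_diff_inverse2)
    finally have "?q \<le> card (?V U)"
      using q by (simp add: power_add)
    then show ?thesis
      using U q by (intro exI[of _ U]) auto
  qed (use VS in blast)
  then obtain U c where U: "?N \<le> card U" "c \<in> ?V U" "c \<noteq> 0"
    using nonzero by blast
  then have "mindist C \<le> card (supp c)"
    using mindist_le_card_supp[OF C] by (auto simp: vanishing_def)
  also have "\<dots> \<le> card (- U)"
    using U by (intro card_mono) (auto simp: supp_def vanishing_def)
  also have "\<dots> = CARD('n) - card U"
    by (simp add: Compl_eq_Diff_UNIV card_Diff_subset)
  finally show ?thesis
    using U N K by linarith
qed

lemma lrc_singleton_bound_ceiling:
  fixes C :: "('n::finite \<Rightarrow> 'f::{finite,field}) set"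
  assumes C: "linear_code C" and lrc: "classical_lrc C r \<delta>" and r: "r \<ge> 1" and \<delta>: "\<delta> \<ge> 2"
    and k: "2 * code_dim C = CARD('n) + k"
  shows "int k + 2 * int (mindist C) + 2 * (\<lceil>real (CARD('n) + k) / real (2 * r)\<rceil> - 1) * (int \<delta> - 1)
    \<le> int CARD('n) + 2"
proof -
  \<comment> \<open>The quotient under the ceiling equals \<open>code_dim C / r\<close>, so this is
    the largest integer \<open>m\<close> with \<open>m * r < code_dim C\<close>. The dimension is
    positive, so \<open>nat\<close> does not truncate.\<close>
  define m where "m = nat (\<lceil>real (CARD('n) + k) / real (2 * r)\<rceil> - 1)"
  have "CARD('n) > 0"
    by simp
  have K: "real (CARD('n) + k) / real (2 * r) = real (code_dim C) / real r"
    unfolding k[symmetric] using r by simp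
  have pos: "code_dim C > 0"
    using k \<open>CARD('n) > 0\<close> by linarith
  then have "real (code_dim C) / real r > 0"
    using r by simp
  then have m: "int m = \<lceil>real (CARD('n) + k) / real (2 * r)\<rceil> - 1"
    unfolding m_def K by (simp add: le_ceiling_iff)
  then have "real m < real (code_dim C) / real r"
    unfolding K by linarith
  then have "real (m * r) < real (code_dim C)"
    using r by (simp add: field_simps)
  then have "m * r < code_dim C"
    by linarith
  then have "code_dim C + mindist C + m * (\<delta> - 1) \<le> CARD('n) + 1"
    by (rule lrc_singleton_bound[OF C lrc \<delta>])
  moreover have "int (m * (\<delta> - 1)) = int m * (int \<delta> - 1)"
    using \<delta> by (simp add: of_nat_diff)
  ultimately have "int (code_dim C) + int (mindist C) + int m * (int \<delta> - 1) \<le> int CARD('n) + 1"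
    by linarith
  then show ?thesis
    unfolding m[symmetric] using k by linarith
qed

section \<open>Operators and Pauli matrices\<close>

definition oscale :: "complex \<Rightarrow> ('n, 'a) qop \<Rightarrow> ('n, 'a) qop" where
  "oscale c A = (\<lambda>x y. c * A x y)"

lemma sum_fun_apply: "(\<Sum>i\<in>S. f i) x = (\<Sum>i\<in>S. f i x)"
  by (induction S rule: infinite_finite_induct) auto

lemma oscale_oscale [simp]: "oscale c (oscale d A) = oscale (c * d) A"
  by (simp add: oscale_def mult.assoc)

lemma oscale_1 [simp]: "oscale 1 A = A"
  by (simp add: oscale_def)

lemma oscale_sum: "oscale c (\<Sum>i\<in>S. f i) = (\<Sum>i\<in>S. oscale c (f i))"
  by (simp add: oscale_def fun_eq_iff sum_fun_apply sum_distrib_left)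

lemma oscale_eq_imp_0:
  assumes "oscale c A = oscale d A" "c \<noteq> d"
  shows "A = 0"
  using assms by (auto simp: oscale_def fun_eq_iff)

lemma mmul_assoc: "mmul (mmul A B) C = mmul A (mmul B C)"
proof -
  have "(\<Sum>z\<in>UNIV. (\<Sum>w\<in>UNIV. A x w * B w z) * C z y) = (\<Sum>w\<in>UNIV. A x w * (\<Sum>z\<in>UNIV. B w z * C z y))" for x y
    by (simp add: sum_distrib_left sum_distrib_right mult.assoc) (rule sum.swap)
  then show ?thesis
    by (simp add: mmul_def)
qed

lemma mmul_oscale_left: "mmul (oscale c A) B = oscale c (mmul A B)"
  and mmul_oscale_right: "mmul A (oscale c B) = oscale c (mmul A B)"
  by (simp_all add: mmul_def oscale_def sum_distrib_left ac_simps)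

lemma mmul_scalar_left: "mmul (scalar_op c) A = oscale c A"
  and mmul_scalar_right: "mmul A (scalar_op c) = oscale c A"
  by (simp_all add: mmul_def oscale_def scalar_op_def if_distrib[of "\<lambda>x. x * _"] if_distrib[of "\<lambda>x. _ * x"] mult.commute cong: if_cong)

lemma oscale_scalar_op: "oscale c (scalar_op d) = scalar_op (c * d)"
  by (simp add: oscale_def scalar_op_def fun_eq_iff)

lemma mmul_sum_left: "mmul (\<Sum>i\<in>S. f i) A = (\<Sum>i\<in>S. mmul (f i) A)"
  and mmul_sum_right: "mmul A (\<Sum>i\<in>S. f i) = (\<Sum>i\<in>S. mmul A (f i))"
proof -
  show "mmul (\<Sum>i\<in>S. f i) A = (\<Sum>i\<in>S. mmul (f i) A)"
    by (simp add: mmul_def fun_eq_iff sum_fun_apply sum_distrib_right) (intro allI sum.swap)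
  show "mmul A (\<Sum>i\<in>S. f i) = (\<Sum>i\<in>S. mmul A (f i))"
    by (simp add: mmul_def fun_eq_iff sum_fun_apply sum_distrib_left) (intro allI sum.swap)
qed

lemma mmul_diff_left: "mmul (A - B) C = mmul A C - mmul B C"
  and mmul_diff_right: "mmul C (A - B) = mmul C A - mmul C B"
  by (simp_all add: mmul_def fun_eq_iff algebra_simps sum_subtractf)

lemma mmul_0_left [simp]: "mmul 0 A = 0"
  and mmul_0_right [simp]: "mmul A 0 = 0"
  by (simp_all add: mmul_def fun_eq_iff)

lemma adj_mmul: "adj (mmul A B) = mmul (adj B) (adj A)"
  by (simp add: adj_def mmul_def fun_eq_iff mult.commute)

lemma adj_oscale: "adj (oscale c A) = oscale (cnj c) (adj A)"
  by (simp add: adj_def oscale_def)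

lemma adj_sum: "adj (\<Sum>i\<in>S. f i) = (\<Sum>i\<in>S. adj (f i))"
  by (simp add: adj_def fun_eq_iff sum_fun_apply)

lemma adj_diff: "adj (A - B) = adj A - adj B"
  by (simp add: adj_def fun_eq_iff)

lemma adj_adj [simp]: "adj (adj A) = A"
  by (simp add: adj_def)

lemma adj_scalar_1: "adj (scalar_op 1) = scalar_op 1"
  by (auto simp: adj_def scalar_op_def fun_eq_iff)

lemma app_mmul: "app (mmul A B) v = app A (app B v)"
proof -
  have "(\<Sum>y\<in>UNIV. (\<Sum>z\<in>UNIV. A x z * B z y) * v y) = (\<Sum>z\<in>UNIV. A x z * (\<Sum>y\<in>UNIV. B z y * v y))" for x
    by (simp add: sum_distrib_left sum_distrib_right mult.assoc) (rule sum.swap)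
  then show ?thesis
    by (simp add: app_def mmul_def)
qed

lemma app_oscale: "app (oscale c A) v = cscale c (app A v)"
  by (simp add: app_def oscale_def cscale_def sum_distrib_left ac_simps)

lemma app_cscale: "app A (cscale c v) = cscale c (app A v)"
  by (simp add: app_def cscale_def sum_distrib_left ac_simps)

lemma app_sum: "app (\<Sum>i\<in>S. f i) v = (\<Sum>i\<in>S. app (f i) v)"
  by (simp add: app_def fun_eq_iff sum_fun_apply sum_distrib_right) (intro allI sum.swap)

lemma app_diff: "app (A - B) v = app A v - app B v"
  by (simp add: app_def fun_eq_iff algebra_simps sum_subtractf)

lemma app_scalar_op: "app (scalar_op c) v = cscale c v"
  by (simp add: app_def scalar_op_def cscale_def if_distrib[of "\<lambda>x. x * _"] cong: if_cong)

lemma app_0_left [simp]: "app 0 v = 0"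
  and app_0_right [simp]: "app A 0 = 0"
  by (simp_all add: app_def fun_eq_iff)

lemma cscale_cscale [simp]: "cscale c (cscale d v) = cscale (c * d) v"
  by (simp add: cscale_def mult.assoc)

lemma cscale_1 [simp]: "cscale 1 v = v"
  by (simp add: cscale_def)

lemma cinner_app: "cinner u (app A v) = cinner (app (adj A) u) v"
proof -
  have "(\<Sum>x\<in>UNIV. cnj (u x) * (\<Sum>y\<in>UNIV. A x y * v y)) = (\<Sum>y\<in>UNIV. cnj (\<Sum>x\<in>UNIV. cnj (A x y) * u x) * v y)"
    by (simp add: sum_distrib_left sum_distrib_right ac_simps) (rule sum.swap)
  then show ?thesis
    by (simp add: cinner_def app_def adj_def)
qed

section \<open>Products, adjoints and commutation of error operators\<close>

lemma chi_sum: "chi (\<Sum>i\<in>S. f i) = (\<Prod>i\<in>S. chi (f i))"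
  by (induction S rule: infinite_finite_induct) (auto simp: chi_add)

text \<open>The operator sends the basis state \<open>y\<close> to \<open>y + a\<close> with phase
  \<open>chi (ip b y)\<close>; the phases of the single qudits combine because \<open>chi\<close>
  turns sums into products.\<close>

lemma pauli_eq: "pauli a b x y = (if x = y + a then chi (ip b y) else 0)"
proof (cases "x = y + a")
  case True
  then show ?thesis
    by (simp add: pauli_def XZ1_def ip_def chi_sum flip: chi_def)
next
  case False
  then obtain j where "x j \<noteq> y j + a j"
    by (auto simp: fun_eq_iff)
  then have "pauli a b x y = 0"
    unfolding pauli_def by (intro prod_zero) (auto simp: XZ1_def)
  then show ?thesis
    using False by simp
qed

text \<open>Error operators are indexed by pairs \<open>w = (a, b)\<close>, standing for \<open>(a|b)\<close>.\<close>

abbreviation pauli_pair :: "('n::finite \<Rightarrow> 'a::{finite,field}) \<times> ('n \<Rightarrow> 'a) \<Rightarrow> ('n, 'a) qop" where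
  "pauli_pair w \<equiv> pauli (fst w) (snd w)"

definition symp :: "('n::finite \<Rightarrow> 'a::comm_ring_1) \<times> ('n \<Rightarrow> 'a) \<Rightarrow> ('n \<Rightarrow> 'a) \<times> ('n \<Rightarrow> 'a) \<Rightarrow> 'a" where
  "symp w z = ip (fst w) (snd z) - ip (snd w) (fst z)"

lemma pauli_mult:
  "mmul (pauli_pair w) (pauli_pair z) = oscale (chi (ip (snd w) (fst z))) (pauli_pair (w + z))"
proof (intro ext)
  fix x y
  have "mmul (pauli_pair w) (pauli_pair z) x y
      = (\<Sum>u\<in>UNIV. if u = y + fst z then pauli_pair w x u * chi (ip (snd z) y) else 0)"
    unfolding mmul_def by (intro sum.cong) (auto simp: pauli_eq)
  also have "\<dots> = pauli_pair w x (y + fst z) * chi (ip (snd z) y)"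
    by simp
  also have "\<dots> = oscale (chi (ip (snd w) (fst z))) (pauli_pair (w + z)) x y"
    by (simp add: pauli_eq oscale_def ip_add_left ip_add_right chi_add add_ac)
  finally show "mmul (pauli_pair w) (pauli_pair z) x y = oscale (chi (ip (snd w) (fst z))) (pauli_pair (w + z)) x y" .
qed

lemma pauli_0: "pauli 0 0 = scalar_op 1"
  by (auto simp: pauli_eq scalar_op_def fun_eq_iff)

lemma adj_pauli: "adj (pauli_pair w) = oscale (chi (ip (snd w) (fst w))) (pauli_pair (- w))"
proof (intro ext)
  fix x y
  have iff: "y = x + fst w \<longleftrightarrow> x = y + - fst w"
    by (metis add_diff_cancel diff_add_cancel diff_conv_add_uminus)
  show "adj (pauli_pair w) x y = oscale (chi (ip (snd w) (fst w))) (pauli_pair (- w)) x y"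
  proof (cases "y = x + fst w")
    case True
    then show ?thesis
      using iff by (simp add: adj_def oscale_def pauli_eq cnj_chi ip_diff_right ip_minus_left flip: chi_add)
  next
    case False
    then show ?thesis
      using iff by (simp add: adj_def oscale_def pauli_eq)
  qed
qed

lemma adj_pauli_mult_pauli:
  "mmul (adj (pauli_pair w)) (pauli_pair z) = oscale (chi (ip (snd w) (fst w - fst z))) (pauli_pair (z - w))"
proof -
  have "- w + z = z - w"
    by simp
  then show ?thesis
    unfolding adj_pauli mmul_oscale_left pauli_mult
    by (simp add: ip_minus_left ip_diff_right flip: chi_add)
qed

lemma adj_pauli_mult_self: "mmul (adj (pauli_pair w)) (pauli_pair w) = scalar_op 1"
  unfolding adj_pauli_mult_pauli by (simp add: pauli_0)

lemma pauli_commute: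
  "mmul (pauli_pair w) (pauli_pair z) = oscale (chi (- symp w z)) (mmul (pauli_pair z) (pauli_pair w))"
  unfolding pauli_mult
  by (simp add: symp_def add.commute ip_commute[of "snd z"] flip: chi_add)

section \<open>Stabilizer projections\<close>

text \<open>Covers the Hermitian and the Euclidean construction at once: in both, \<open>D\<close>
  is a group stable under scaling by the small field. Commutation of the operators indexed by
  \<open>D\<close> is forced by the existence of the character.\<close>

locale stabilizer =
  fixes D :: "(('n::finite \<Rightarrow> 'a::{finite,field}) \<times> ('n \<Rightarrow> 'a)) set"
    and chr :: "('n, 'a) qop \<Rightarrow> complex"
  assumes zero_D: "0 \<in> D"
    and diff_D: "w \<in> D \<Longrightarrow> z \<in> D \<Longrightarrow> w - z \<in> D"
    and scale_D: "w \<in> D \<Longrightarrow> (vscale c (fst w), vscale c (snd w)) \<in> D"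
    and stab_char: "stab_char D chr"
begin

abbreviation lam :: "('n \<Rightarrow> 'a) \<times> ('n \<Rightarrow> 'a) \<Rightarrow> complex" where
  "lam w \<equiv> chr (pauli_pair w)"

lemma minus_D: "w \<in> D \<Longrightarrow> - w \<in> D"
  using diff_D[OF zero_D] by fastforce

lemma add_D: "w \<in> D \<Longrightarrow> z \<in> D \<Longrightarrow> w + z \<in> D"
  using diff_D[OF _ minus_D] by fastforce

lemma chr_mult: "A \<in> stab_group D \<Longrightarrow> B \<in> stab_group D \<Longrightarrow> chr (mmul A B) = chr A * chr B"
  using stab_char unfolding stab_char_def by blast

section \<open>Values of the character on phases and error operators\<close>

lemma scalar_power_in_stab_group: "scalar_op (xi TYPE('a) ^ n) \<in> stab_group D"
  using stab_group.scal[of "int n"] by simp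

lemma chr_scalar_power: "chr (scalar_op (xi TYPE('a) ^ n)) = xi TYPE('a) ^ n"
proof -
  have Suc: "chr (scalar_op (xi TYPE('a) ^ Suc n)) = xi TYPE('a) ^ Suc n" for n
  proof (induction n)
    case 0
    then show ?case
      using stab_char by (simp add: stab_char_def)
  next
    case (Suc n)
    have "scalar_op (xi TYPE('a) ^ Suc (Suc n)) =
        mmul (scalar_op (xi TYPE('a) ^ 1)) (scalar_op (xi TYPE('a) ^ Suc n) :: ('n, 'a) qop)"
      by (simp add: mmul_scalar_left oscale_scalar_op)
    then have "chr (scalar_op (xi TYPE('a) ^ Suc (Suc n))) = chr (scalar_op (xi TYPE('a) ^ 1)) * chr (scalar_op (xi TYPE('a) ^ Suc n))"
      by (simp only: chr_mult[OF scalar_power_in_stab_group scalar_power_in_stab_group])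
    then show ?case
      using Suc stab_char by (simp add: stab_char_def)
  qed
  \<comment> \<open>\<open>stab_char\<close> prescribes the value at \<open>xi\<close>, not at the
    identity. The induction therefore starts at exponent 1, and exponent \<open>n\<close> is reached
    as \<open>n + CHAR('a)\<close>.\<close>
  have "xi TYPE('a) ^ n = xi TYPE('a) ^ (n + CHAR('a))"
    by (simp add: power_add xi_power_CHAR)
  moreover obtain k where "n + CHAR('a) = Suc k"
    using prime_gt_0_nat[OF prime_CHAR_finite_field[where 'a = 'a]] by (cases "n + CHAR('a)") auto
  ultimately show ?thesis
    using Suc by metis
qed

lemma chr_scalar_powi: "chr (scalar_op (xi TYPE('a) powi l)) = xi TYPE('a) powi l"
proof (cases "l \<ge> 0")
  case True
  then show ?thesis
    using chr_scalar_power[of "nat l"] by (simp add: power_int_def)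
next
  case False
  let ?n = "nat (- l)"
  have l: "xi TYPE('a) powi l = inverse (xi TYPE('a) ^ ?n)"
    using False by (simp add: power_int_def power_inverse)
  have "mmul (scalar_op (xi TYPE('a) powi l)) (scalar_op (xi TYPE('a) ^ ?n)) = (scalar_op (xi TYPE('a) ^ 0) :: ('n, 'a) qop)"
    by (simp add: mmul_scalar_left oscale_scalar_op l xi_neq_0)
  then have "chr (scalar_op (xi TYPE('a) powi l)) * chr (scalar_op (xi TYPE('a) ^ ?n)) = 1"
    using chr_mult[OF stab_group.scal scalar_power_in_stab_group] chr_scalar_power[of 0]
    by (metis power_0)
  then show ?thesis
    by (simp add: chr_scalar_power l field_simps xi_neq_0)
qed

lemma lam_0: "lam 0 = 1"
  using chr_scalar_power[of 0] by (simp add: pauli_0)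

text \<open>The phase in a product of error operators is a power of \<open>xi\<close>, so its scalar
  operator lies in the group and \<open>chr\<close> maps it to the phase itself.\<close>

lemma lam_mult:
  assumes "w \<in> D" "z \<in> D"
  shows "lam w * lam z = chi (ip (snd w) (fst z)) * lam (w + z)"
proof -
  let ?c = "chi (ip (snd w) (fst z))"
  have "lam w * lam z = chr (mmul (scalar_op ?c) (pauli_pair (w + z)))"
    using assms by (simp add: chr_mult[symmetric] stab_group.gen pauli_mult mmul_scalar_left)
  also have "\<dots> = ?c * lam (w + z)"
    unfolding chi_def
    by (simp only: chr_mult[OF scalar_power_in_stab_group stab_group.gen[OF add_D[OF assms]]] chr_scalar_power)
  finally show ?thesis .
qed

lemma lam_neq_0:
  assumes "w \<in> D"
  shows "lam w \<noteq> 0"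
  using lam_mult[OF assms minus_D[OF assms]] lam_0 by auto

text \<open>Phases have norm 1, so the norm of \<open>lam\<close> is multiplicative along the
  multiples of \<open>w\<close>; the \<open>CHAR('a)\<close>-th multiple is zero.\<close>

lemma norm_lam:
  assumes "w \<in> D"
  shows "norm (lam w) = 1"
proof -
  define mul where "mul n = (vscale (of_nat n) (fst w), vscale (of_nat n) (snd w))" for n
  have mul_D: "mul n \<in> D" for n
    unfolding mul_def by (rule scale_D[OF assms])
  have "norm (lam (mul n)) = norm (lam w) ^ n" for n
  proof (induction n)
    case 0
    have "mul 0 = 0"
      by (simp add: mul_def vscale_def prod_eq_iff fun_eq_iff)
    then show ?case
      by (simp only: lam_0 norm_one power_0)
  next
    case (Suc n)
    have "mul (Suc n) = w + mul n"
      by (simp add: mul_def vscale_def prod_eq_iff fun_eq_iff algebra_simps)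
    then have "norm (lam (mul (Suc n))) = norm (lam w * lam (mul n))"
      by (simp add: lam_mult[OF assms mul_D] norm_mult)
    then show ?case
      by (simp add: Suc norm_mult)
  qed
  moreover have "mul CHAR('a) = 0"
    by (simp add: mul_def vscale_def prod_eq_iff fun_eq_iff)
  ultimately have "norm (lam w) ^ CHAR('a) = 1"
    using lam_0 by (metis norm_one)
  then show ?thesis
    using prime_gt_0_nat[OF prime_CHAR_finite_field[where 'a = 'a]]
    by (intro power_eq_imp_eq_base[of _ "CHAR('a)" 1]) auto
qed

lemma cnj_lam: "w \<in> D \<Longrightarrow> cnj (lam w) = inverse (lam w)"
  using complex_norm_square[of "lam w"] norm_lam by (simp add: inverse_unique)

lemma stab_code_iff: "v \<in> stab_code D chr \<longleftrightarrow> (\<forall>w\<in>D. app (pauli_pair w) v = cscale (lam w) v)"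
proof
  assume "v \<in> stab_code D chr"
  then show "\<forall>w\<in>D. app (pauli_pair w) v = cscale (lam w) v"
    by (auto simp: stab_code_def cscale_def intro: stab_group.gen)
next
  assume *: "\<forall>w\<in>D. app (pauli_pair w) v = cscale (lam w) v"
  have "app A v = cscale (chr A) v" if "A \<in> stab_group D" for A
    using that
  proof induction
    case (scal l)
    then show ?case
      by (simp add: app_scalar_op chr_scalar_powi)
  next
    case (mult A B)
    then show ?case
      by (simp add: app_mmul app_cscale chr_mult mult.commute)
  qed (use * in blast)
  then show "v \<in> stab_code D chr"
    by (simp add: stab_code_def cscale_def)
qed

text \<open>\<open>G\<close> varies because two choices matter: \<open>D\<close> itself gives the
  projection onto the code, and the part of \<open>D\<close> supported in a recovery set gives a
  projection acting on that set only.\<close>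

definition stab_proj :: "(('n \<Rightarrow> 'a) \<times> ('n \<Rightarrow> 'a)) set \<Rightarrow> ('n, 'a) qop" where
  "stab_proj G = oscale (1 / card G) (\<Sum>w\<in>G. oscale (inverse (lam w)) (pauli_pair w))"

definition subgroup_D :: "(('n \<Rightarrow> 'a) \<times> ('n \<Rightarrow> 'a)) set \<Rightarrow> bool" where
  "subgroup_D G \<longleftrightarrow> G \<subseteq> D \<and> 0 \<in> G \<and> (\<forall>w\<in>G. \<forall>z\<in>G. w - z \<in> G)"

lemma subgroup_D_minus: "subgroup_D G \<Longrightarrow> w \<in> G \<Longrightarrow> - w \<in> G"
  unfolding subgroup_D_def by (metis diff_0)

lemma subgroup_D_add: "subgroup_D G \<Longrightarrow> w \<in> G \<Longrightarrow> z \<in> G \<Longrightarrow> w + z \<in> G"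
  using subgroup_D_minus[of G z] unfolding subgroup_D_def by (metis diff_minus_eq_add)

text \<open>Translation by \<open>w\<close> permutes the summands, and the phase of the operator
  product cancels against the one in \<open>lam_mult\<close>.\<close>

lemma pauli_mult_stab_proj:
  assumes G: "subgroup_D G" and w: "w \<in> G"
  shows "mmul (pauli_pair w) (stab_proj G) = oscale (lam w) (stab_proj G)"
proof -
  have GD: "z \<in> G \<Longrightarrow> z \<in> D" for z
    using G by (auto simp: subgroup_D_def)
  have coeff: "inverse (lam z) * chi (ip (snd w) (fst z)) = lam w * inverse (lam (w + z))" if "z \<in> G" for z
    using lam_mult[OF GD[OF w] GD[OF that]] lam_neq_0[OF GD[OF that]]
      lam_neq_0[OF GD[OF subgroup_D_add[OF G w that]]] by (simp add: field_simps)
  have bij: "bij_betw ((+) w) G G"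
    by (rule bij_betw_byWitness[where f' = "\<lambda>z. z - w"])
       (use w G in \<open>auto simp: subgroup_D_add subgroup_D_def\<close>)
  have "(\<Sum>z\<in>G. mmul (pauli_pair w) (oscale (inverse (lam z)) (pauli_pair z)))
      = (\<Sum>z\<in>G. oscale (lam w) (oscale (inverse (lam (w + z))) (pauli_pair (w + z))))"
    by (intro sum.cong) (simp_all only: mmul_oscale_right pauli_mult oscale_oscale coeff)
  also have "\<dots> = (\<Sum>z\<in>G. oscale (lam w) (oscale (inverse (lam z)) (pauli_pair z)))"
    by (rule sum.reindex_bij_betw[OF bij])
  finally show ?thesis
    unfolding stab_proj_def mmul_oscale_right mmul_sum_right
    by (simp add: oscale_sum[symmetric] mult.commute del: oscale_oscale) (simp add: mult.commute)
qed

text \<open>Taking adjoints exchanges the summands of \<open>w\<close> and \<open>- w\<close>; the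
  coefficients match because the eigenvalues lie on the unit circle.\<close>

lemma adj_stab_proj:
  assumes G: "subgroup_D G"
  shows "adj (stab_proj G) = stab_proj G"
proof -
  have GD: "z \<in> G \<Longrightarrow> z \<in> D" for z
    using G by (auto simp: subgroup_D_def)
  have coeff: "lam w * chi (ip (snd w) (fst w)) = inverse (lam (- w))" if "w \<in> G" for w
  proof -
    have "lam w * lam (- w) = chi (ip (snd w) (fst (- w))) * lam (w + - w)"
      by (rule lam_mult[OF GD[OF that] minus_D[OF GD[OF that]]])
    then have "lam w * lam (- w) = inverse (chi (ip (snd w) (fst w)))"
      using lam_0 by (simp add: ip_minus_right chi_minus)
    then have "(lam w * chi (ip (snd w) (fst w))) * lam (- w) = 1"
      by (simp add: field_simps)
    then show ?thesis
      by (metis inverse_unique mult.commute)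
  qed
  have bij: "bij_betw uminus G G"
    by (rule bij_betw_byWitness[where f' = uminus]) (use subgroup_D_minus[OF G] in auto)
  have "(\<Sum>w\<in>G. adj (oscale (inverse (lam w)) (pauli_pair w)))
      = (\<Sum>w\<in>G. oscale (inverse (lam (- w))) (pauli_pair (- w)))"
    by (intro sum.cong) (simp_all only: adj_oscale adj_pauli oscale_oscale complex_cnj_inverse cnj_lam[OF GD] inverse_inverse_eq coeff)
  also have "\<dots> = (\<Sum>w\<in>G. oscale (inverse (lam w)) (pauli_pair w))"
    by (rule sum.reindex_bij_betw[OF bij])
  finally show ?thesis
    unfolding stab_proj_def adj_oscale adj_sum by simp
qed

text \<open>Multiplication from the left by the inverse \<open>adj (pauli_pair w)\<close> gives the
  inverse eigenvalue; taking adjoints of that equation moves the operator to the right.\<close>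

lemma stab_proj_mult_pauli:
  assumes G: "subgroup_D G" and w: "w \<in> G"
  shows "mmul (stab_proj G) (pauli_pair w) = oscale (lam w) (stab_proj G)"
proof -
  have wD: "w \<in> D"
    using G w by (auto simp: subgroup_D_def)
  have "mmul (adj (pauli_pair w)) (oscale (lam w) (stab_proj G)) = stab_proj G"
    unfolding pauli_mult_stab_proj[OF assms, symmetric] mmul_assoc[symmetric] adj_pauli_mult_self
    by (simp add: mmul_scalar_left)
  then have "oscale (inverse (lam w)) (oscale (lam w) (mmul (adj (pauli_pair w)) (stab_proj G)))
      = oscale (inverse (lam w)) (stab_proj G)"
    by (simp add: mmul_oscale_right)
  then have "mmul (adj (pauli_pair w)) (stab_proj G) = oscale (inverse (lam w)) (stab_proj G)"
    using lam_neq_0[OF wD] by simp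
  then have "adj (mmul (adj (pauli_pair w)) (stab_proj G)) = adj (oscale (inverse (lam w)) (stab_proj G))"
    by simp
  then show ?thesis
    unfolding adj_mmul adj_oscale adj_stab_proj[OF G] by (simp add: cnj_lam[OF wD])
qed

lemma stab_proj_idem:
  assumes G: "subgroup_D G"
  shows "mmul (stab_proj G) (stab_proj G) = stab_proj G"
proof -
  have "mmul (oscale (inverse (lam w)) (pauli_pair w)) (stab_proj G) = stab_proj G" if "w \<in> G" for w
  proof -
    have "w \<in> D"
      using G that by (auto simp: subgroup_D_def)
    then show ?thesis
      unfolding mmul_oscale_left pauli_mult_stab_proj[OF G that] by (simp add: lam_neq_0)
  qed
  then have "mmul (\<Sum>w\<in>G. oscale (inverse (lam w)) (pauli_pair w)) (stab_proj G) = (\<Sum>w\<in>G. stab_proj G)"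
    unfolding mmul_sum_left by simp
  also have "\<dots> = oscale (card G) (stab_proj G)"
    by (simp add: fun_eq_iff oscale_def)
  finally have "mmul (oscale (1 / card G) (\<Sum>w\<in>G. oscale (inverse (lam w)) (pauli_pair w))) (stab_proj G)
      = oscale (1 / card G) (oscale (card G) (stab_proj G))"
    by (simp only: mmul_oscale_left)
  moreover have "card G \<noteq> 0"
    using G by (auto simp: subgroup_D_def)
  ultimately show ?thesis
    unfolding stab_proj_def[symmetric] by simp
qed

lemma app_stab_proj:
  assumes G: "subgroup_D G" and v: "v \<in> stab_code D chr"
  shows "app (stab_proj G) v = v"
proof -
  have "app (oscale (inverse (lam w)) (pauli_pair w)) v = v" if "w \<in> G" for w
  proof -
    have "w \<in> D"
      using G that by (auto simp: subgroup_D_def)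
    then show ?thesis
      using v by (simp add: stab_code_iff app_oscale lam_neq_0)
  qed
  then have "app (stab_proj G) v = cscale (1 / card G) (\<Sum>w\<in>G. v)"
    by (simp add: stab_proj_def app_oscale app_sum)
  moreover have "card G \<noteq> 0"
    using G by (auto simp: subgroup_D_def)
  ultimately show ?thesis
    by (simp add: cscale_def fun_eq_iff)
qed

lemma subgroup_D_self: "subgroup_D D"
  by (simp add: subgroup_D_def zero_D diff_D)

lemma app_stab_proj_in: "app (stab_proj D) v \<in> stab_code D chr"
  by (simp add: stab_code_iff pauli_mult_stab_proj[OF subgroup_D_self] app_oscale flip: app_mmul)

end

section \<open>Dimension and error detection\<close>

lemma cscale_eq_vscale: "cscale = vscale"
  by (simp add: cscale_def vscale_def fun_eq_iff)

lemma finite_independent_fun: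
  fixes B :: "('i::finite \<Rightarrow> 'f::field) set"
  assumes "vscale.independent B"
  shows "finite B"
proof -
  define e :: "'i \<Rightarrow> 'i \<Rightarrow> 'f" where "e x = (\<lambda>y. if y = x then 1 else 0)" for x
  have "v \<in> vscale.span (range e)" for v
  proof -
    have "v = (\<Sum>x\<in>UNIV. vscale (v x) (e x))"
      by (simp add: fun_eq_iff sum_fun_apply vscale_def e_def if_distrib cong: if_cong)
    also have "\<dots> \<in> vscale.span (range e)"
      by (intro vscale.span_sum vscale.span_scale vscale.span_base) simp
    finally show ?thesis .
  qed
  then have "B \<subseteq> vscale.span (range e)"
    by (rule subsetI)
  then show ?thesis
    using vscale.independent_span_bound[of "range e" B] assms by simp
qed

text \<open>Expanding the columns of \<open>P\<close> in a basis \<open>B\<close> of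
  \<open>Q\<close> splits the trace into one term for each element of \<open>B\<close>, and each
  term is 1 because \<open>P\<close> fixes that element.\<close>

lemma dim_eq_trace_of_projection:
  fixes P :: "('n::finite, 'a::finite) qop"
  assumes Q: "module.subspace cscale Q"
    and into: "\<And>v. app P v \<in> Q" and fixed: "\<And>v. v \<in> Q \<Longrightarrow> app P v = v"
  shows "of_nat (vector_space.dim cscale Q) = (\<Sum>x\<in>UNIV. P x x)"
proof -
  obtain B where B: "B \<subseteq> Q" "vscale.independent B" "Q \<subseteq> vscale.span B" "card B = vscale.dim Q"
    using vscale.basis_exists by blast
  have fin: "finite B"
    by (rule finite_independent_fun[OF B(2)])
  define f where "f b x = vscale.representation B (\<lambda>y. P y x) b" for b x
  have col: "(\<lambda>y. P y x) \<in> vscale.span B" for x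
  proof -
    have "app P (\<lambda>y. if y = x then 1 else 0) = (\<lambda>y. P y x)"
      by (simp add: app_def if_distrib cong: if_cong)
    then show ?thesis
      using into B(3) by (metis subsetD)
  qed
  have expand: "P y x = (\<Sum>b\<in>B. f b x * b y)" for x y
  proof -
    have "(\<Sum>b\<in>B. vscale (f b x) b) = (\<lambda>y. P y x)"
      unfolding f_def by (rule vscale.sum_representation_eq[OF B(2) col fin order_refl])
    from fun_cong[OF this, of y] show ?thesis
      by (simp add: sum_fun_apply vscale_def)
  qed
  \<comment> \<open>By linearity this sum is the coefficient of \<open>b\<close> in the expansion of
    \<open>app P b\<close>, which is \<open>b\<close>.\<close>
  have diag: "(\<Sum>x\<in>UNIV. f b x * b x) = 1" if b: "b \<in> B" for b
  proof -
    have "(\<Sum>x\<in>UNIV. f b x * b x) = (\<Sum>x\<in>UNIV. vscale.representation B (vscale (b x) (\<lambda>y. P y x)) b)"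
      by (simp add: f_def vscale.representation_scale[OF B(2) col] mult.commute)
    also have "\<dots> = vscale.representation B (\<Sum>x\<in>UNIV. vscale (b x) (\<lambda>y. P y x)) b"
      by (simp add: vscale.representation_sum[OF B(2)] vscale.span_scale col)
    also have "(\<Sum>x\<in>UNIV. vscale (b x) (\<lambda>y. P y x)) = app P b"
      by (simp add: fun_eq_iff sum_fun_apply vscale_def app_def mult.commute)
    also have "\<dots> = b"
      using fixed B(1) b by blast
    finally show ?thesis
      by (simp add: vscale.representation_basis[OF B(2) b])
  qed
  have "(\<Sum>x\<in>UNIV. P x x) = (\<Sum>b\<in>B. \<Sum>x\<in>UNIV. f b x * b x)"
    unfolding expand by (rule sum.swap)
  also have "\<dots> = of_nat (card B)"
    by (simp add: diag)
  finally show ?thesis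
    using B(4) by (simp add: cscale_eq_vscale)
qed

text \<open>A nonzero \<open>fst w\<close> moves every basis state, so the diagonal is zero;
  otherwise the trace is a character sum, zero unless \<open>snd w = 0\<close>.\<close>

lemma trace_pauli:
  fixes w :: "('n::finite \<Rightarrow> 'a::{finite,field}) \<times> ('n \<Rightarrow> 'a)"
  shows "(\<Sum>x\<in>UNIV. pauli_pair w x x) = (if w = 0 then of_nat (CARD('a) ^ CARD('n)) else 0)"
proof (cases "fst w = 0")
  case True
  then have w: "w = 0 \<longleftrightarrow> snd w = 0"
    by (simp add: prod_eq_iff)
  show ?thesis
  proof (cases "snd w = 0")
    case True
    then show ?thesis
      using \<open>fst w = 0\<close> w by (simp add: pauli_0 scalar_op_def card_fun)
  next
    case False
    then show ?thesis
      using \<open>fst w = 0\<close> w by (simp add: pauli_eq sum_chi_ip_UNIV)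
  qed
next
  case False
  then have "pauli_pair w x x = 0" for x
    by (simp add: pauli_eq)
  then show ?thesis
    using False by auto
qed

section \<open>The stabilizer code as the image of its projection\<close>

context stabilizer
begin

lemma subspace_stab_code: "module.subspace cscale (stab_code D chr)"
proof -
  have "vscale.subspace (stab_code D chr)"
    unfolding vscale.subspace_def
  proof (intro conjI ballI allI)
    fix u v assume uv: "u \<in> stab_code D chr" "v \<in> stab_code D chr"
    have "app A (u + v) = app A u + app A v" for A :: "('n, 'a) qop"
      by (simp add: app_def fun_eq_iff algebra_simps sum.distrib)
    then show "u + v \<in> stab_code D chr"
      using uv by (simp add: stab_code_iff) (simp add: cscale_def fun_eq_iff algebra_simps)
  next
    fix c u assume "u \<in> stab_code D chr"
    then show "vscale c u \<in> stab_code D chr"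
      by (simp add: stab_code_iff app_cscale mult.commute flip: cscale_eq_vscale)
  qed (simp add: stab_code_iff app_def cscale_def fun_eq_iff)
  then show ?thesis
    by (simp add: cscale_eq_vscale)
qed

lemma trace_stab_proj: "(\<Sum>x\<in>UNIV. stab_proj D x x) = of_nat (CARD('a) ^ CARD('n)) / of_nat (card D)"
proof -
  have "(\<Sum>x\<in>UNIV. stab_proj D x x)
      = (\<Sum>x\<in>UNIV. 1 / of_nat (card D) * (\<Sum>w\<in>D. inverse (lam w) * pauli_pair w x x))"
    by (simp add: stab_proj_def oscale_def sum_fun_apply)
  also have "\<dots> = 1 / of_nat (card D) * (\<Sum>w\<in>D. inverse (lam w) * (\<Sum>x\<in>UNIV. pauli_pair w x x))"
    unfolding sum_distrib_left by (rule sum.swap)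
  also have "\<dots> = 1 / of_nat (card D) * (\<Sum>w\<in>D. if w = 0 then of_nat (CARD('a) ^ CARD('n)) else 0)"
    unfolding trace_pauli using lam_0 by (intro arg_cong2[where f = "(*)"] sum.cong) auto
  finally show ?thesis
    using zero_D by simp
qed

lemma dim_stab_code:
  assumes "card D * CARD('a) ^ k = CARD('a) ^ CARD('n)"
  shows "vector_space.dim cscale (stab_code D chr) = CARD('a) ^ k"
proof -
  have "complex_of_nat (vector_space.dim cscale (stab_code D chr))
      = of_nat (CARD('a) ^ CARD('n)) / of_nat (card D)"
    unfolding trace_stab_proj[symmetric]
    by (rule dim_eq_trace_of_projection[OF subspace_stab_code app_stab_proj_in app_stab_proj[OF subgroup_D_self]])
  also have "\<dots> = of_nat (CARD('a) ^ k)"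
  proof -
    have "card D \<noteq> 0"
      using zero_D by auto
    then show ?thesis
      unfolding assms[symmetric] by simp
  qed
  finally show ?thesis
    by (simp only: of_nat_eq_iff)
qed

text \<open>The projection absorbs the operator of \<open>w\<close> on either side with the same
  eigenvalue, but moving it across the operator of \<open>z\<close> costs a phase other than 1. So
  the product equals a nontrivial multiple of itself.\<close>

lemma stab_proj_pauli_stab_proj:
  assumes G: "subgroup_D G" and w: "w \<in> G" "chi (symp w z) \<noteq> 1"
  shows "mmul (mmul (stab_proj G) (pauli_pair z)) (stab_proj G) = 0"
proof -
  let ?P = "stab_proj G" and ?X = "mmul (mmul (stab_proj G) (pauli_pair z)) (stab_proj G)"
  have wD: "w \<in> D"
    using G w by (auto simp: subgroup_D_def)
  have "oscale (lam w) ?X = mmul (mmul ?P (pauli_pair z)) (mmul (pauli_pair w) ?P)"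
    by (simp add: pauli_mult_stab_proj[OF G w(1)] mmul_oscale_right)
  also have "\<dots> = mmul ?P (mmul (mmul (pauli_pair z) (pauli_pair w)) ?P)"
    by (simp only: mmul_assoc)
  also have "\<dots> = oscale (chi (- symp z w)) (mmul (mmul ?P (pauli_pair w)) (mmul (pauli_pair z) ?P))"
    unfolding pauli_commute[of z w] mmul_oscale_left mmul_oscale_right by (simp only: mmul_assoc)
  also have "\<dots> = oscale (chi (symp w z) * lam w) ?X"
    by (simp add: stab_proj_mult_pauli[OF G w(1)] mmul_oscale_left mmul_assoc symp_def ip_commute)
  finally show ?thesis
    by (rule oscale_eq_imp_0) (use w(2) lam_neq_0[OF wD] in simp)
qed

lemma qecc_stab_code:
  assumes card: "card D * CARD('a) ^ k = CARD('a) ^ CARD('n)"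
    and det: "\<And>z. z \<noteq> 0 \<Longrightarrow> swt (fst z) (snd z) < d \<Longrightarrow> \<exists>w\<in>D. symp w z \<noteq> 0"
  shows "qecc (stab_code D chr) k d"
  unfolding qecc_def
proof (intro conjI allI impI)
  fix a b :: "'n \<Rightarrow> 'a"
  assume wt: "swt a b < d"
  show "detects (stab_code D chr) (pauli a b)"
  proof (cases "(a, b) = 0")
    case True
    then show ?thesis
      by (auto simp: detects_def pauli_0 app_scalar_op zero_prod_def intro!: exI[of _ 1])
  next
    case False
    then obtain w where "w \<in> D" "symp w (a, b) \<noteq> 0"
      using det[of "(a, b)"] wt by auto
    moreover from this obtain c where "chi (c * symp w (a, b)) \<noteq> 1"
      using chi_mult_nontrivial by blast
    moreover have "symp (vscale c (fst w), vscale c (snd w)) (a, b) = c * symp w (a, b)"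
      by (simp add: symp_def ip_vscale_left algebra_simps)
    ultimately have *: "mmul (mmul (stab_proj D) (pauli a b)) (stab_proj D) = 0"
      using stab_proj_pauli_stab_proj[OF subgroup_D_self scale_D, of w c "(a, b)"] by simp
    have "cinner u (app (pauli a b) v) = 0" if u: "u \<in> stab_code D chr" and v: "v \<in> stab_code D chr" for u v
    proof -
      \<comment> \<open>Both states are fixed by the projection, so it may be inserted on both sides
        of the error.\<close>
      have "cinner u (app (pauli a b) v) = cinner (app (adj (stab_proj D)) u) (app (pauli a b) (app (stab_proj D) v))"
        by (simp add: adj_stab_proj[OF subgroup_D_self] app_stab_proj[OF subgroup_D_self] u v)
      also have "\<dots> = cinner u (app (mmul (mmul (stab_proj D) (pauli a b)) (stab_proj D)) v)"
        by (simp only: cinner_app[symmetric] app_mmul)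
      finally show ?thesis
        by (simp add: * cinner_def)
    qed
    then show ?thesis
      unfolding detects_def by (intro exI[of _ 0]) simp
  qed
qed (simp_all add: subspace_stab_code dim_stab_code[OF card])

end

section \<open>Local recovery\<close>

lemma acts_only_on_0: "acts_only_on J 0"
  unfolding acts_only_on_def by (intro exI[of _ "\<lambda>x y. 0"]) (auto simp: fun_eq_iff)

lemma acts_only_on_add:
  assumes "acts_only_on J A" "acts_only_on J B"
  shows "acts_only_on J (A + B)"
proof -
  obtain A' B' where
    "A = (\<lambda>x y. if \<forall>j. j \<notin> J \<longrightarrow> x j = y j then A' (proj J x) (proj J y) else 0)"
    "B = (\<lambda>x y. if \<forall>j. j \<notin> J \<longrightarrow> x j = y j then B' (proj J x) (proj J y) else 0)"
    using assms unfolding acts_only_on_def by blast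
  then show ?thesis
    unfolding acts_only_on_def by (intro exI[of _ "A' + B'"]) (auto simp: fun_eq_iff)
qed

lemma acts_only_on_oscale:
  assumes "acts_only_on J A"
  shows "acts_only_on J (oscale c A)"
proof -
  obtain A' where "A = (\<lambda>x y. if \<forall>j. j \<notin> J \<longrightarrow> x j = y j then A' (proj J x) (proj J y) else 0)"
    using assms unfolding acts_only_on_def by blast
  then show ?thesis
    unfolding acts_only_on_def by (intro exI[of _ "oscale c A'"]) (auto simp: fun_eq_iff oscale_def)
qed

lemma acts_only_on_diff:
  assumes "acts_only_on J A" "acts_only_on J B"
  shows "acts_only_on J (A - B)"
proof -
  have "A - B = A + oscale (- 1) B"
    by (simp add: oscale_def fun_eq_iff)
  then show ?thesis
    by (simp only: acts_only_on_add acts_only_on_oscale assms)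
qed

lemma acts_only_on_sum: "(\<And>i. i \<in> S \<Longrightarrow> acts_only_on J (f i)) \<Longrightarrow> acts_only_on J (\<Sum>i\<in>S. f i)"
  by (induction S rule: infinite_finite_induct) (auto simp: acts_only_on_0 acts_only_on_add)

text \<open>In the matrix product only intermediate indices that agree with \<open>y\<close> outside
  \<open>J\<close> contribute, so the sum runs over their \<open>J\<close>-parts.\<close>

lemma acts_only_on_mmul:
  fixes A B :: "('n::finite, 'a::{finite,zero}) qop"
  assumes "acts_only_on J A" "acts_only_on J B"
  shows "acts_only_on J (mmul A B)"
proof -
  let ?R = "\<lambda>x y :: 'n \<Rightarrow> 'a. \<forall>j. j \<notin> J \<longrightarrow> x j = y j"
  obtain A' where A: "A = (\<lambda>x y. if ?R x y then A' (proj J x) (proj J y) else 0)"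
    using assms(1) unfolding acts_only_on_def by blast
  obtain B' where B: "B = (\<lambda>x y. if ?R x y then B' (proj J x) (proj J y) else 0)"
    using assms(2) unfolding acts_only_on_def by blast
  have "mmul A B x y = (if ?R x y then \<Sum>z | \<forall>j. j \<notin> J \<longrightarrow> z j = 0. A' (proj J x) z * B' z (proj J y) else 0)" for x y
  proof (cases "?R x y")
    case True
    have "mmul A B x y = (\<Sum>z | ?R z y. A x z * B z y)"
      unfolding mmul_def by (rule sum.mono_neutral_right) (auto simp: B)
    \<comment> \<open>An index is recovered from its \<open>J\<close>-part by filling in the values
      of \<open>y\<close> outside \<open>J\<close>.\<close>
    also have "\<dots> = (\<Sum>z | \<forall>j. j \<notin> J \<longrightarrow> z j = 0. A' (proj J x) z * B' z (proj J y))"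
      by (rule sum.reindex_bij_witness[where i = "\<lambda>z j. if j \<in> J then z j else y j" and j = "proj J"])
         (use True in \<open>auto simp: A B proj_def fun_eq_iff\<close>)
    finally show ?thesis
      using True by simp
  next
    case False
    then have "A x z * B z y = 0" for z
      by (auto simp: A B)
    then have "mmul A B x y = 0"
      unfolding mmul_def by (intro sum.neutral) blast
    then show ?thesis
      unfolding if_not_P[OF False] .
  qed
  then show ?thesis
    unfolding acts_only_on_def
    by (intro exI[of _ "\<lambda>u v. \<Sum>z | \<forall>j. j \<notin> J \<longrightarrow> z j = 0. A' u z * B' z v"]) (simp add: fun_eq_iff)
qed

lemma acts_only_on_pauli:
  assumes "supp a \<subseteq> J" "supp b \<subseteq> J"
  shows "acts_only_on J (pauli a b)"
proof -
  have a: "a j = 0" if "j \<notin> J" for j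
    using assms(1) that by (auto simp: supp_def)
  have "pauli a b x y = (if \<forall>j. j \<notin> J \<longrightarrow> x j = y j then pauli a b (proj J x) (proj J y) else 0)" for x y
  proof -
    have "x = y + a \<longleftrightarrow> (\<forall>j. j \<notin> J \<longrightarrow> x j = y j) \<and> proj J x = proj J y + a"
      using a by (simp add: fun_eq_iff proj_def) (metis add.right_neutral)
    moreover have "ip b (proj J y) = ip b y"
      using assms(2) by (metis ip_proj proj_eq_iff)
    ultimately show ?thesis
      by (auto simp: pauli_eq)
  qed
  then show ?thesis
    unfolding acts_only_on_def by (intro exI[of _ "pauli a b"]) (simp add: fun_eq_iff)
qed

section \<open>Errors on a set of qudits and the depolarizing channel\<close>

definition errors_on :: "'n set \<Rightarrow> (('n \<Rightarrow> 'a::zero) \<times> ('n \<Rightarrow> 'a)) set" where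
  "errors_on I = {w. supp (fst w) \<subseteq> I \<and> supp (snd w) \<subseteq> I}"

lemma errors_on_iff: "w \<in> errors_on I \<longleftrightarrow> (\<forall>j. j \<notin> I \<longrightarrow> fst w j = 0 \<and> snd w j = 0)"
  by (auto simp: errors_on_def supp_def)

text \<open>For the full space as code, the upper and the lower estimate for
  \<open>vanishing\<close> meet.\<close>

lemma card_supp_subset: "card {f :: 'n::finite \<Rightarrow> 'a::{finite,field}. supp f \<subseteq> I} = CARD('a) ^ card I"
proof -
  let ?V = "vanishing (UNIV :: ('n \<Rightarrow> 'a) set)"
  have UNIV: "linear_code (UNIV :: ('n \<Rightarrow> 'a) set)"
    by (rule linear_codeI) auto
  have "card (?V {}) \<le> CARD('a) ^ card (- I) * card (?V (- I))"
    using card_vanishing_Un[OF UNIV, of "{}" "- I"] by simp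
  then have "CARD('a) ^ CARD('n) \<le> CARD('a) ^ card (- I) * card (?V (- I))"
    by (simp add: vanishing_def card_fun)
  with card_vanishing_le[OF UNIV, of "- I"]
  have "card (?V (- I)) * CARD('a) ^ card (- I) = CARD('a) ^ CARD('n)"
    by (simp add: mult.commute)
  also have "CARD('n) = card I + card (- I)"
    using card_Un_disjoint[of I "- I"] by simp
  finally have "card (?V (- I)) = CARD('a) ^ card I"
    by (simp add: power_add)
  moreover have "{f. supp f \<subseteq> I} = ?V (- I)"
    by (auto simp: vanishing_def supp_def)
  ultimately show ?thesis
    by simp
qed

lemma card_errors_on:
  "card (errors_on I :: (('n::finite \<Rightarrow> 'a::{finite,field}) \<times> ('n \<Rightarrow> 'a)) set) = CARD('a) ^ (2 * card I)"
proof -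
  have "(errors_on I :: (('n \<Rightarrow> 'a) \<times> ('n \<Rightarrow> 'a)) set) = {f. supp f \<subseteq> I} \<times> {f. supp f \<subseteq> I}"
    by (auto simp: errors_on_def)
  then show ?thesis
    by (simp add: card_cartesian_product card_supp_subset power_mult power2_eq_square power_mult_distrib)
qed

lemma conj_by_proj_state: "conj_by A (proj_state \<phi>) = proj_state (app A \<phi>)"
  by (simp add: conj_by_def proj_state_def mmul_def app_def adj_def fun_eq_iff sum_distrib_left sum_distrib_right mult_ac)

text \<open>The depolarized state is a uniform mixture of corrupted states, so recovery means
  undoing an unknown error on \<open>I\<close>.\<close>

lemma Gamma_proj_state:
  "Gamma I (proj_state \<phi>) = oscale (1 / of_nat (CARD('a) ^ (2 * card I)))
     (\<Sum>z\<in>errors_on I. proj_state (app (pauli_pair z) (\<phi> :: ('n::finite, 'a::{finite,field}) qstate)))"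
proof -
  have "{(a, b). \<forall>j. j \<notin> I \<longrightarrow> a j = 0 \<and> b j = 0} = (errors_on I :: (('n \<Rightarrow> 'a) \<times> ('n \<Rightarrow> 'a)) set)"
    by (auto simp: errors_on_def supp_def)
  then show ?thesis
    by (simp add: Gamma_def oscale_def fun_eq_iff sum_fun_apply conj_by_proj_state)
qed

lemma conj_by_oscale: "conj_by A (oscale c \<rho>) = oscale c (conj_by A \<rho>)"
  by (simp add: conj_by_def mmul_oscale_left mmul_oscale_right)

lemma conj_by_sum: "conj_by A (\<Sum>i\<in>S. f i) = (\<Sum>i\<in>S. conj_by A (f i))"
  by (simp add: conj_by_def mmul_sum_left mmul_sum_right)

lemma proj_state_0: "proj_state 0 = 0"
  by (simp add: proj_state_def fun_eq_iff)

text \<open>The difference of two distinct errors on \<open>I\<close> is again a nonzero error on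
  \<open>I\<close>, hence detected by a stabilizer supported in \<open>J\<close>. So different
  errors move the image of the local projection \<open>P\<close> to orthogonal spaces, which a
  measurement on \<open>J\<close> tells apart.\<close>

lemma (in stabilizer) locally_recoverable_stab_code:
  assumes IJ: "I \<subseteq> J"
    and det: "\<And>z. z \<noteq> 0 \<Longrightarrow> z \<in> errors_on I \<Longrightarrow> \<exists>w\<in>D \<inter> errors_on J. symp w z \<noteq> 0"
  shows "locally_recoverable (stab_code D chr) I J"
proof -
  let ?E = "errors_on I :: (('n \<Rightarrow> 'a) \<times> ('n \<Rightarrow> 'a)) set"
  define G where "G = D \<inter> errors_on J"
  define P where "P = stab_proj G"
  define Kr where "Kr z = mmul P (adj (pauli_pair z))" for z :: "('n \<Rightarrow> 'a) \<times> ('n \<Rightarrow> 'a)"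
  \<comment> \<open>\<open>T z\<close> is the projection onto the image of \<open>P\<close> moved by
    the error \<open>z\<close>, and \<open>Kr z\<close> moves that image back.\<close>
  define T where "T z = mmul (pauli_pair z) (Kr z)" for z
  \<comment> \<open>The projection onto what no error on \<open>I\<close> reaches; it completes the
    Kraus operators to a trace-preserving family and annihilates every corrupted code state.\<close>
  define R where "R = scalar_op 1 - (\<Sum>z\<in>?E. T z)"
  have G: "subgroup_D G"
    by (auto simp: subgroup_D_def G_def zero_D diff_D errors_on_iff)
  have PP: "mmul P P = P" and adjP: "adj P = P"
    using stab_proj_idem[OF G] adj_stab_proj[OF G] by (simp_all add: P_def)

  have orth: "mmul (mmul (Kr y) (pauli_pair z)) P = (if y = z then P else 0)" if y: "y \<in> ?E" and z: "z \<in> ?E" for y z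
  proof (cases "y = z")
    case True
    then show ?thesis
      by (simp add: Kr_def mmul_assoc PP)
         (simp add: mmul_assoc[symmetric] adj_pauli_mult_self mmul_scalar_right PP)
  next
    case False
    have "z - y \<noteq> 0" "z - y \<in> ?E"
      using y z False by (auto simp: errors_on_iff)
    then obtain w where w: "w \<in> G" "symp w (z - y) \<noteq> 0"
      using det unfolding G_def by blast
    then obtain c where c: "chi (c * symp w (z - y)) \<noteq> 1"
      using chi_mult_nontrivial by blast
    have "(vscale c (fst w), vscale c (snd w)) \<in> G"
      using w scale_D by (auto simp: G_def errors_on_iff vscale_def)
    moreover have "symp (vscale c (fst w), vscale c (snd w)) (z - y) = c * symp w (z - y)"
      by (simp add: symp_def ip_vscale_left algebra_simps)
    ultimately have "mmul (mmul P (pauli_pair (z - y))) P = 0"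
      using stab_proj_pauli_stab_proj[OF G] c unfolding P_def by metis
    moreover have "mmul (mmul (Kr y) (pauli_pair z)) P
        = mmul (mmul P (mmul (adj (pauli_pair y)) (pauli_pair z))) P"
      by (simp only: Kr_def mmul_assoc)
    ultimately show ?thesis
      using False unfolding adj_pauli_mult_pauli mmul_oscale_left mmul_oscale_right
      by (simp add: oscale_def fun_eq_iff)
  qed
  have adjKr: "adj (Kr z) = mmul (pauli_pair z) P" for z
    by (simp add: Kr_def adj_mmul adjP)
  have PKr: "mmul P (Kr z) = Kr z" for z
    by (simp add: Kr_def mmul_assoc[symmetric] PP)
  have T_eq: "T z = mmul (adj (Kr z)) (Kr z)" for z
    unfolding T_def adjKr mmul_assoc PKr ..
  have adjT: "adj (T z) = T z" for z
    by (simp add: T_eq adj_mmul)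
  have TT: "mmul (T y) (T z) = (if y = z then T z else 0)" if "y \<in> ?E" "z \<in> ?E" for y z
  proof -
    have "mmul (T y) (T z) = mmul (pauli_pair y) (mmul (mmul (mmul (Kr y) (pauli_pair z)) P) (Kr z))"
      unfolding T_def by (simp only: mmul_assoc PKr)
    then show ?thesis
      by (simp add: orth[OF that] PKr T_def)
  qed
  have RR: "mmul (adj R) R = R"
  proof -
    have adjR: "adj R = R"
      by (simp add: R_def adj_diff adj_sum adjT adj_scalar_1)
    have "mmul (\<Sum>z\<in>?E. T z) (\<Sum>z\<in>?E. T z) = (\<Sum>y\<in>?E. mmul (T y) (\<Sum>z\<in>?E. T z))"
      by (rule mmul_sum_left)
    also have "\<dots> = (\<Sum>y\<in>?E. \<Sum>z\<in>?E. mmul (T y) (T z))"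
      by (simp only: mmul_sum_right)
    also have "\<dots> = (\<Sum>y\<in>?E. \<Sum>z\<in>?E. if y = z then T z else 0)"
      by (intro sum.cong refl) (simp add: TT)
    also have "\<dots> = (\<Sum>z\<in>?E. T z)"
      by simp
    finally show ?thesis
      unfolding adjR by (simp add: R_def mmul_diff_left mmul_diff_right mmul_scalar_left mmul_scalar_right)
  qed

  have Kr_app: "app (Kr y) (app (pauli_pair z) \<phi>) = (if y = z then \<phi> else 0)"
    if "\<phi> \<in> stab_code D chr" "y \<in> ?E" "z \<in> ?E" for \<phi> y z
  proof -
    have P\<phi>: "app P \<phi> = \<phi>"
      unfolding P_def by (rule app_stab_proj[OF G that(1)])
    then have "app (Kr y) (app (pauli_pair z) \<phi>) = app (mmul (mmul (Kr y) (pauli_pair z)) P) \<phi>"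
      by (simp add: app_mmul)
    then show ?thesis
      by (simp add: orth[OF that(2,3)] P\<phi>)
  qed
  have R_app: "app R (app (pauli_pair z) \<phi>) = 0" if "\<phi> \<in> stab_code D chr" "z \<in> ?E" for \<phi> z
  proof -
    have "(\<Sum>y\<in>?E. app (T y) (app (pauli_pair z) \<phi>)) = (\<Sum>y\<in>?E. if y = z then app (pauli_pair z) \<phi> else 0)"
      by (intro sum.cong refl) (simp add: T_def app_mmul Kr_app[OF that(1) _ that(2)])
    then show ?thesis
      using that(2) by (simp add: R_def app_diff app_sum app_scalar_op)
  qed

  \<comment> \<open>Kraus operators are numbered by naturals: the errors take the first
    \<open>card ?E\<close> places, and \<open>R\<close> the last.\<close>
  obtain h where h: "bij_betw h {..<card ?E} ?E"
    using ex_bij_betw_nat_finite[OF finite, of ?E] by (auto simp: atLeast0LessThan)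
  define K where "K i = (if i < card ?E then Kr (h i) else R)" for i
  have sum_K: "(\<Sum>i<Suc (card ?E). f (K i)) = (\<Sum>z\<in>?E. f (Kr z)) + f R" for f :: "_ \<Rightarrow> ('n, 'a) qop"
    using sum.reindex_bij_betw[OF h, of "\<lambda>z. f (Kr z)"] by (simp add: K_def)

  have acts_pauli: "acts_only_on J (pauli_pair z)" if "z \<in> errors_on J" for z :: "('n \<Rightarrow> 'a) \<times> ('n \<Rightarrow> 'a)"
    using that by (intro acts_only_on_pauli) (auto simp: errors_on_def)
  have acts_P: "acts_only_on J P"
    unfolding P_def stab_proj_def
    by (intro acts_only_on_oscale acts_only_on_sum acts_pauli) (auto simp: G_def)
  have EJ: "z \<in> errors_on J" "- z \<in> errors_on J" if "z \<in> ?E" for z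
    using IJ that unfolding errors_on_iff by auto
  have acts_Kr: "acts_only_on J (Kr z)" if "z \<in> ?E" for z
    unfolding Kr_def adj_pauli
    by (intro acts_only_on_mmul acts_P acts_only_on_oscale acts_pauli) (use EJ that in auto)
  have acts_1: "acts_only_on J (scalar_op 1 :: ('n, 'a) qop)"
    using acts_pauli[of 0] by (simp add: errors_on_iff pauli_0)
  have acts_R: "acts_only_on J R"
    unfolding R_def T_def
    by (intro acts_only_on_diff acts_1 acts_only_on_sum acts_only_on_mmul acts_pauli acts_Kr) (use EJ in auto)

  show ?thesis
    unfolding locally_recoverable_def
  proof (intro exI[of _ K] exI[of _ "Suc (card ?E)"] conjI ballI)
    have "(\<Sum>i<Suc (card ?E). mmul (adj (K i)) (K i)) = scalar_op 1"
      unfolding sum_K[of "\<lambda>A. mmul (adj A) A"] T_eq[symmetric] RR by (simp add: R_def)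
    from fun_cong[OF fun_cong[OF this]]
    have "(\<Sum>i<Suc (card ?E). mmul (adj (K i)) (K i) x y) = scalar_op 1 x y" for x y
      unfolding sum_fun_apply .
    moreover have "acts_only_on J (K i)" for i
      using acts_Kr acts_R bij_betwE[OF h] by (simp add: K_def)
    ultimately show "local_tp_operation J K (Suc (card ?E))"
      unfolding local_tp_operation_def by blast
  next
    fix \<phi> assume \<phi>: "\<phi> \<in> stab_code D chr"
    let ?c = "1 / complex_of_nat (CARD('a) ^ (2 * card I))"
    let ?\<rho> = "Gamma I (proj_state \<phi>)"
    have conj: "conj_by A ?\<rho> = oscale ?c (\<Sum>z\<in>?E. proj_state (app A (app (pauli_pair z) \<phi>)))" for A
      by (simp only: Gamma_proj_state conj_by_oscale conj_by_sum conj_by_proj_state)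
    have conj_Kr: "conj_by (Kr y) ?\<rho> = oscale ?c (proj_state \<phi>)" if "y \<in> ?E" for y
    proof -
      have "(\<Sum>z\<in>?E. proj_state (app (Kr y) (app (pauli_pair z) \<phi>))) = (\<Sum>z\<in>?E. if y = z then proj_state \<phi> else 0)"
        by (intro sum.cong refl) (simp add: Kr_app[OF \<phi> that] proj_state_0)
      then show ?thesis
        using that by (simp add: conj)
    qed
    have conj_R: "conj_by R ?\<rho> = 0"
      by (simp add: conj R_app[OF \<phi>] proj_state_0) (simp add: oscale_def fun_eq_iff)
    have "(\<Sum>i<Suc (card ?E). conj_by (K i) ?\<rho>) = (\<Sum>z\<in>?E. oscale ?c (proj_state \<phi>))"
      unfolding sum_K[of "\<lambda>A. conj_by A ?\<rho>"] conj_R by (simp add: conj_Kr)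
    also have "\<dots> = oscale (of_nat (card ?E)) (oscale ?c (proj_state \<phi>))"
      by (simp add: oscale_def fun_eq_iff)
    \<comment> \<open>The number of errors on \<open>I\<close> cancels the normalization of the
      channel.\<close>
    also have "\<dots> = proj_state \<phi>"
      unfolding card_errors_on oscale_oscale by simp
    finally show "apply_operation K (Suc (card ?E)) ?\<rho> = proj_state \<phi>"
      by (simp add: apply_operation_def fun_eq_iff sum_fun_apply del: sum.lessThan_Suc)
  qed
qed

section \<open>The quantum codes of dual-containing codes\<close>

text \<open>The detection hypothesis serves twice: with \<open>J\<close> a recovery set it gives
  local recovery, and with \<open>J = UNIV\<close>, where \<open>proj\<close> is the identity, it
  gives the distance.\<close>

lemma (in stabilizer) quantum_lrc_and_qecc:
  fixes C :: "('n \<Rightarrow> 'f::zero) set"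
  assumes lrc: "classical_lrc C r \<delta>" and \<delta>: "\<delta> \<ge> 2"
    and card: "card D * CARD('a) ^ k = CARD('a) ^ CARD('n)"
    and det: "\<And>J z. z \<noteq> 0 \<Longrightarrow> z \<in> errors_on J \<Longrightarrow> swt (fst z) (snd z) < mindist (proj J ` C) \<Longrightarrow>
      \<exists>w\<in>D \<inter> errors_on J. symp w z \<noteq> 0"
  shows "quantum_lrc (stab_code D chr) r \<delta> \<and> qecc (stab_code D chr) k (mindist C)"
proof
  show "quantum_lrc (stab_code D chr) r \<delta>"
    unfolding quantum_lrc_def
  proof
    fix i
    obtain J where J: "i \<in> J" "card J \<le> r + \<delta> - 1" "mindist (proj J ` C) \<ge> \<delta>"
      using lrc unfolding classical_lrc_def by blast
    have "locally_recoverable (stab_code D chr) I J" if I: "I \<subset> J" "card I = \<delta> - 1" for I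
    proof (rule locally_recoverable_stab_code)
      fix z :: "('n \<Rightarrow> 'a) \<times> ('n \<Rightarrow> 'a)"
      assume z: "z \<noteq> 0" "z \<in> errors_on I"
      have "swt (fst z) (snd z) \<le> card I"
        unfolding swt_def using z by (intro card_mono) (auto simp: errors_on_iff)
      then have "swt (fst z) (snd z) < mindist (proj J ` C)"
        using I J \<delta> by linarith
      moreover have "z \<in> errors_on J"
        using z I by (auto simp: errors_on_def)
      ultimately show "\<exists>w\<in>D \<inter> errors_on J. symp w z \<noteq> 0"
        using det z by blast
    qed (use I in blast)
    then show "\<exists>J. i \<in> J \<and> card J \<le> r + \<delta> - 1 \<and>
        (\<forall>I. I \<subset> J \<and> I \<noteq> {} \<and> card I = \<delta> - 1 \<longrightarrow> locally_recoverable (stab_code D chr) I J)"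
      using J by blast
  qed
  have "proj UNIV = (\<lambda>c :: 'n \<Rightarrow> 'f. c)"
    by (simp add: proj_def fun_eq_iff)
  then show "qecc (stab_code D chr) k (mindist C)"
    using det[where J = UNIV] by (intro qecc_stab_code[OF card]) (auto simp: errors_on_def)
qed

text \<open>The two components of an error are tested separately: a dual word in the second
  component of a stabilizer detects \<open>fst z\<close>, one in the first detects
  \<open>snd z\<close>.\<close>

lemma edual_times_edual_lrc:
  fixes C :: "('n::finite \<Rightarrow> 'a::{finite,field}) set"
  assumes C: "linear_code C" and k: "2 * code_dim C = CARD('n) + k"
    and lrc: "classical_lrc C r \<delta>" and \<delta>: "\<delta> \<ge> 2"
    and chr: "stab_char (edual C \<times> edual C) chr"
  shows "quantum_lrc (stab_code (edual C \<times> edual C) chr) r \<delta> \<and>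
    qecc (stab_code (edual C \<times> edual C) chr) k (mindist C)"
proof -
  note lin = linear_code_edual[of C]
  interpret stabilizer "edual C \<times> edual C" chr
    by unfold_locales
       (use lin chr in \<open>auto simp: linear_code_0 zero_prod_def linear_code_diff linear_code_vscale\<close>)
  show ?thesis
  proof (rule quantum_lrc_and_qecc[OF lrc \<delta>])
    have "card C ^ 2 = CARD('a) ^ CARD('n) * CARD('a) ^ k"
      unfolding card_linear_code[OF C] power_mult[symmetric] power_add[symmetric] k[symmetric]
      by (simp only: mult.commute)
    \<comment> \<open>Multiplying by \<open>CARD('a) ^ CARD('n)\<close> turns the factor
      \<open>CARD('a) ^ k\<close> into \<open>card C ^ 2\<close>, so that the product formula for
      the dual applies.\<close>
    then have "CARD('a) ^ CARD('n) * (card (edual C \<times> edual C) * CARD('a) ^ k) = (card C * card (edual C)) ^ 2"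
      by (simp add: card_cartesian_product power_mult_distrib) (simp add: power2_eq_square)
    also have "\<dots> = CARD('a) ^ CARD('n) * CARD('a) ^ CARD('n)"
      by (simp only: card_code_times_edual[OF C] power2_eq_square)
    finally show "card (edual C \<times> edual C) * CARD('a) ^ k = CARD('a) ^ CARD('n)"
      by simp
  next
    fix J and z :: "('n \<Rightarrow> 'a) \<times> ('n \<Rightarrow> 'a)"
    assume z: "z \<noteq> 0" "z \<in> errors_on J" "swt (fst z) (snd z) < mindist (proj J ` C)"
    have zero: "(0 :: 'n \<Rightarrow> 'a) \<in> edual C" "supp (0 :: 'n \<Rightarrow> 'a) = {}"
      by (simp_all add: linear_code_0[OF lin])
    have "card (supp (fst z)) \<le> swt (fst z) (snd z)" "card (supp (snd z)) \<le> swt (fst z) (snd z)"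
      unfolding swt_def by (auto simp: supp_def intro!: card_mono)
    then have wt: "card (supp (fst z)) < mindist (proj J ` C)" "card (supp (snd z)) < mindist (proj J ` C)"
      using z(3) by linarith+
    have supp: "supp (fst z) \<subseteq> J" "supp (snd z) \<subseteq> J"
      using z(2) by (auto simp: errors_on_def)
    show "\<exists>w\<in>(edual C \<times> edual C) \<inter> errors_on J. symp w z \<noteq> 0"
    proof (cases "fst z = 0")
      case False
      obtain u where u: "u \<in> edual C" "supp u \<subseteq> J" "ip (fst z) u \<noteq> 0"
        using low_weight_not_orthogonal_to_local_dual[OF C False supp(1) wt(1)] by blast
      then show ?thesis
        by (intro bexI[of _ "(0, u)"]) (auto simp: zero symp_def errors_on_def ip_commute[of u])
    next
      case True
      then have "snd z \<noteq> 0"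
        using z(1) by (simp add: prod_eq_iff)
      then obtain u where u: "u \<in> edual C" "supp u \<subseteq> J" "ip (snd z) u \<noteq> 0"
        using low_weight_not_orthogonal_to_local_dual[OF C _ supp(2) wt(2)] by blast
      then show ?thesis
        by (intro bexI[of _ "(u, 0)"]) (auto simp: zero symp_def errors_on_def ip_commute[of u])
    qed
  qed
qed

section \<open>Quadratic extensions and Hermitian duality\<close>

locale quadratic_extension =
  fixes emb :: "'a::{finite,field} \<Rightarrow> 'b::{finite,field}" and s :: 'b and q :: nat
  assumes q_eq: "q = CARD('a)"
    and CARD_square: "CARD('b) = CARD('a) ^ 2"
    and field_embedding: "field_embedding emb"
    and normal_basis: "normal_basis_elt emb s"
begin

lemma q_neq_0 [simp]: "q \<noteq> 0"
  by (simp add: q_eq)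

lemma CARD_eq_q_square: "CARD('b) = q ^ 2"
  by (simp add: q_eq CARD_square)

lemma emb_simps [simp]: "emb 1 = 1" "emb (x + y) = emb x + emb y" "emb (x * y) = emb x * emb y" "emb 0 = 0"
proof -
  show *: "emb 1 = 1" "emb (x + y) = emb x + emb y" "emb (x * y) = emb x * emb y" for x y
    using field_embedding by (auto simp: field_embedding_def)
  show "emb 0 = 0"
    using *(2)[of 0 0] by (metis add.right_neutral add_left_cancel)
qed

lemma emb_diff [simp]: "emb (x - y) = emb x - emb y"
  using emb_simps(2)[of "x - y" y] by (simp add: algebra_simps)

lemma emb_sum: "emb (\<Sum>i\<in>S. f i) = (\<Sum>i\<in>S. emb (f i))"
  by (induction S rule: infinite_finite_induct) auto

lemma emb_power_q [simp]: "emb x ^ q = emb x"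
proof -
  have "emb x ^ n = emb (x ^ n)" for n
    by (induction n) auto
  then show ?thesis
    by (simp only: q_eq finite_field_power_CARD)
qed

lemma power_q_power_q [simp]: "(x ^ q) ^ q = (x :: 'b)"
  using finite_field_power_CARD[of x] by (simp add: CARD_eq_q_square power2_eq_square power_mult)

text \<open>The two fields have the same characteristic, since one characteristic divides a power of
  the other. This makes the \<open>q\<close>-th power map additive on the large field.\<close>

lemma q_eq_CHAR_power: "q = CHAR('b) ^ ext_deg TYPE('a)"
proof -
  have "CHAR('b) dvd CHAR('b) ^ ext_deg TYPE('b) \<or> ext_deg TYPE('b) = 0"
    by (cases "ext_deg TYPE('b)") auto
  moreover have "card {0, 1 :: 'b} \<le> CARD('b)"
    by (rule card_mono) auto
  ultimately have "CHAR('b) dvd CARD('b)"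
    using CARD_eq_CHAR_power_ext_deg[where 'a = 'b] by auto
  then have "CHAR('b) dvd CHAR('a)"
    unfolding CARD_square CARD_eq_CHAR_power_ext_deg[where 'a = 'a]
    using prime_dvd_power prime_CHAR_finite_field by blast
  then have "CHAR('b) = CHAR('a)"
    by (rule primes_dvd_imp_eq[OF prime_CHAR_finite_field prime_CHAR_finite_field])
  then show ?thesis
    using CARD_eq_CHAR_power_ext_deg q_eq by metis
qed

lemma add_power_q: "(x + y) ^ q = x ^ q + (y :: 'b) ^ q"
  by (rule freshmans_dream'[OF prime_CHAR_finite_field q_eq_CHAR_power])

lemma sum_power_q: "(\<Sum>i\<in>S. f i) ^ q = (\<Sum>i\<in>S. (f i :: 'b) ^ q)"
  by (rule freshmans_dream_sum'[OF prime_CHAR_finite_field q_eq_CHAR_power])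

lemma normal_basis_unique:
  assumes "s * emb a + s ^ q * emb b = s * emb c + s ^ q * emb d"
  shows "a = c \<and> b = d"
proof -
  obtain uv where "\<And>uv'. s * emb a + s ^ q * emb b = emb (fst uv') * s + emb (snd uv') * s ^ q \<Longrightarrow> uv' = uv"
    using normal_basis unfolding normal_basis_elt_def q_eq by (metis (no_types, lifting))
  then have "(a, b) = uv" "(c, d) = uv"
    using assms by (simp_all add: mult.commute)
  then show ?thesis
    by blast
qed

text \<open>Otherwise the coordinate pairs \<open>(1, 0)\<close> and \<open>(0, 1)\<close> would
  represent the same element.\<close>

lemma s_neq_conjugate: "s \<noteq> s ^ q"
  using normal_basis_unique[of 1 0 0 1] by auto

definition psi :: "('n \<Rightarrow> 'a) \<times> ('n \<Rightarrow> 'a) \<Rightarrow> 'n \<Rightarrow> 'b" where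
  "psi w = (\<lambda>j. s * emb (fst w j) + s ^ q * emb (snd w j))"

lemma psi_inv_eq: "psi_inv emb s B = psi -` B"
  by (auto simp: psi_inv_def psi_def simp flip: q_eq)

lemma psi_0 [simp]: "psi 0 = 0"
  by (simp add: psi_def fun_eq_iff)

lemma psi_diff: "psi (w - z) = psi w - psi z"
  by (simp add: psi_def fun_eq_iff algebra_simps)

lemma psi_vscale: "psi (vscale c (fst w), vscale c (snd w)) = vscale (emb c) (psi w)"
  by (simp add: psi_def vscale_def fun_eq_iff algebra_simps)

lemma psi_apply_eq_0_iff: "psi w j = 0 \<longleftrightarrow> fst w j = 0 \<and> snd w j = 0"
  using normal_basis_unique[of "fst w j" "snd w j" 0 0] by (auto simp: psi_def)

lemma bij_psi: "bij (psi :: ('n \<Rightarrow> 'a) \<times> ('n \<Rightarrow> 'a) \<Rightarrow> 'n \<Rightarrow> 'b)"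
proof (rule bijI)
  show "inj (psi :: ('n \<Rightarrow> 'a) \<times> ('n \<Rightarrow> 'a) \<Rightarrow> 'n \<Rightarrow> 'b)"
  proof (rule injI)
    fix w z :: "('n \<Rightarrow> 'a) \<times> ('n \<Rightarrow> 'a)" assume "psi w = psi z"
    then have "fst w j = fst z j \<and> snd w j = snd z j" for j
      by (intro normal_basis_unique) (auto simp: psi_def fun_eq_iff)
    then show "w = z"
      by (simp add: prod_eq_iff fun_eq_iff)
  qed
  show "surj (psi :: ('n \<Rightarrow> 'a) \<times> ('n \<Rightarrow> 'a) \<Rightarrow> 'n \<Rightarrow> 'b)"
  proof (rule surjI)
    fix x :: "'n \<Rightarrow> 'b"
    define uv where "uv j = (SOME uv. x j = emb (fst uv) * s + emb (snd uv) * s ^ q)" for j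
    have "x j = emb (fst (uv j)) * s + emb (snd (uv j)) * s ^ q" for j
      unfolding uv_def by (rule someI_ex) (use normal_basis normal_basis_elt_def q_eq in blast)
    then show "psi (\<lambda>j. fst (SOME uv. x j = emb (fst uv) * s + emb (snd uv) * s ^ q),
        \<lambda>j. snd (SOME uv. x j = emb (fst uv) * s + emb (snd uv) * s ^ q)) = x"
      by (simp add: psi_def fun_eq_iff uv_def mult.commute)
  qed
qed

text \<open>Writes the Hermitian product as \<open>ip x (conj_vec y)\<close>, so that facts about
  \<open>edual\<close> carry over to \<open>hdual\<close>.\<close>

definition conj_vec :: "('n \<Rightarrow> 'b) \<Rightarrow> 'n \<Rightarrow> 'b" where
  "conj_vec y = (\<lambda>j. y j ^ q)"

lemma conj_vec_conj_vec [simp]: "conj_vec (conj_vec y) = y"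
  by (simp add: conj_vec_def)

lemma conj_vec_0: "conj_vec 0 = 0"
  by (simp add: conj_vec_def fun_eq_iff power_0_left)

lemma conj_vec_add: "conj_vec (x + y) = conj_vec x + conj_vec y"
  by (simp add: conj_vec_def add_power_q fun_eq_iff)

lemma conj_vec_vscale: "conj_vec (vscale c x) = vscale (c ^ q) (conj_vec x)"
  by (simp add: conj_vec_def vscale_def power_mult_distrib)

lemma supp_conj_vec [simp]: "supp (conj_vec x) = supp x"
  by (simp add: conj_vec_def supp_def)

lemma ip_conj_vec: "ip x (conj_vec y) ^ q = ip (conj_vec x) y"
  by (simp add: ip_def sum_power_q power_mult_distrib conj_vec_def)

lemma hdual_eq: "hdual q C = conj_vec -` edual C"
  by (auto simp: hdual_def edual_def conj_vec_def)

lemma linear_code_hdual: "linear_code (hdual q (C :: ('n::finite \<Rightarrow> 'b) set))"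
  using linear_code_edual[of C] unfolding hdual_eq
  by (intro linear_codeI)
     (auto simp: conj_vec_0 conj_vec_add conj_vec_vscale linear_code_0 linear_code_add linear_code_vscale)

lemma card_hdual: "card (hdual q C) = card (edual (C :: ('n::finite \<Rightarrow> 'b) set))"
proof -
  have "bij (conj_vec :: ('n \<Rightarrow> 'b) \<Rightarrow> 'n \<Rightarrow> 'b)"
    by (rule o_bij[of conj_vec]) (auto simp: fun_eq_iff)
  then show ?thesis
    by (simp add: hdual_eq card_vimage_inj bij_is_inj bij_is_surj)
qed

text \<open>So a vanishing symplectic form only makes the Hermitian form invariant under \<open>x \<mapsto> x ^ q\<close>; since
  the codes are closed under scaling by the larger field, this is enough to make it vanish.\<close>

lemma hermitian_minus_conjugate:
  "ip (psi w) (conj_vec (psi z)) - ip (psi w) (conj_vec (psi z)) ^ q = (s ^ 2 - (s ^ q) ^ 2) * emb (symp w z)"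
proof -
  have conj: "conj_vec (psi z) j = s ^ q * emb (fst z j) + s * emb (snd z j)" for z :: "('n \<Rightarrow> 'a) \<times> ('n \<Rightarrow> 'a)" and j
    by (simp add: conj_vec_def psi_def add_power_q power_mult_distrib)
  have "ip (psi w) (conj_vec (psi z)) - ip (conj_vec (psi w)) (psi z)
      = (\<Sum>j\<in>UNIV. psi w j * conj_vec (psi z) j - conj_vec (psi w) j * psi z j)"
    by (simp add: ip_def sum_subtractf)
  also have "\<dots> = (\<Sum>j\<in>UNIV. (s ^ 2 - (s ^ q) ^ 2) * emb (fst w j * snd z j - snd w j * fst z j))"
  proof (rule sum.cong)
    fix j
    show "psi w j * conj_vec (psi z) j - conj_vec (psi w) j * psi z j
        = (s ^ 2 - (s ^ q) ^ 2) * emb (fst w j * snd z j - snd w j * fst z j)"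
      unfolding conj by (simp add: psi_def power2_eq_square algebra_simps)
  qed simp
  also have "\<dots> = (s ^ 2 - (s ^ q) ^ 2) * emb (symp w z)"
    by (simp add: symp_def ip_def emb_sum sum_distrib_left sum_subtractf[symmetric] del: emb_diff flip: emb_diff)
  finally show ?thesis
    unfolding ip_conj_vec .
qed

lemma hermitian_detection:
  fixes C :: "('n::finite \<Rightarrow> 'b) set"
  assumes C: "linear_code C"
    and z: "z \<noteq> 0" "z \<in> errors_on J" "swt (fst z) (snd z) < mindist (proj J ` C)"
  shows "\<exists>w\<in>psi_inv emb s (hdual q C) \<inter> errors_on J. symp w z \<noteq> 0"
proof -
  have supp: "supp (psi z) = {j. fst z j \<noteq> 0 \<or> snd z j \<noteq> 0}"
    by (auto simp: supp_def psi_apply_eq_0_iff)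
  have "psi z \<noteq> 0"
    using z(1) bij_psi psi_0 by (metis bij_is_inj injD)
  moreover have "supp (psi z) \<subseteq> J"
    using z(2) unfolding supp by (auto simp: errors_on_iff)
  moreover have "card (supp (psi z)) < mindist (proj J ` C)"
    using z(3) unfolding supp swt_def .
  ultimately obtain u where u: "u \<in> edual C" "supp u \<subseteq> J" "ip (psi z) u \<noteq> 0"
    using low_weight_not_orthogonal_to_local_dual[OF C] by blast
  let ?v = "conj_vec u"
  define h where "h = ip ?v (conj_vec (psi z))"
  have "h = ip u (psi z) ^ q"
    unfolding h_def using ip_conj_vec[of u "conj_vec (psi z)"] by simp
  then have h: "h \<noteq> 0"
    using u(3) by (simp add: ip_commute)
  \<comment> \<open>The Hermitian dual is closed under scaling by the large field. The factor
    \<open>s / h\<close> gives the Hermitian form the value \<open>s\<close>, which differs from its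
    conjugate, so the symplectic form cannot vanish.\<close>
  obtain w where w: "psi w = vscale (s / h) ?v"
    using bij_psi by (metis bij_pointE)
  have "?v \<in> hdual q C"
    using u(1) by (simp add: hdual_eq)
  then have "w \<in> psi_inv emb s (hdual q C)"
    by (simp add: psi_inv_eq w linear_code_vscale[OF linear_code_hdual])
  moreover have "w \<in> errors_on J"
  proof -
    have "psi w j = 0" if "j \<notin> J" for j
    proof -
      have "j \<notin> supp ?v"
        using u(2) that by auto
      then show ?thesis
        by (simp add: w vscale_def supp_def)
    qed
    then show ?thesis
      by (simp add: errors_on_iff psi_apply_eq_0_iff)
  qed
  moreover have "symp w z \<noteq> 0"
  proof
    assume "symp w z = 0"
    then have "ip (psi w) (conj_vec (psi z)) = ip (psi w) (conj_vec (psi z)) ^ q"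
      using hermitian_minus_conjugate[of w z] by simp
    moreover have "ip (psi w) (conj_vec (psi z)) = s"
      using h by (simp add: w ip_vscale_left flip: h_def)
    ultimately show False
      using s_neq_conjugate by simp
  qed
  ultimately show ?thesis
    by blast
qed

lemma hdual_lrc:
  fixes C :: "('n::finite \<Rightarrow> 'b) set"
  assumes C: "linear_code C" and k: "2 * code_dim C = CARD('n) + k"
    and lrc: "classical_lrc C r \<delta>" and \<delta>: "\<delta> \<ge> 2"
    and chr: "stab_char (psi_inv emb s (hdual q C)) chr"
  shows "quantum_lrc (stab_code (psi_inv emb s (hdual q C)) chr) r \<delta> \<and>
    qecc (stab_code (psi_inv emb s (hdual q C)) chr) k (mindist C)"
proof -
  note lin = linear_code_hdual[of C]
  interpret stabilizer "psi_inv emb s (hdual q C)" chr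
    by unfold_locales
       (use lin chr in \<open>auto simp: psi_inv_eq psi_diff psi_vscale linear_code_0 linear_code_diff linear_code_vscale\<close>)
  show ?thesis
  proof (rule quantum_lrc_and_qecc[OF lrc \<delta> _ hermitian_detection[OF C]], unfold q_eq[symmetric])
    have "card (psi_inv emb s (hdual q C)) = card (edual C)"
      unfolding psi_inv_eq card_hdual[symmetric]
      by (rule card_vimage_inj) (simp_all add: bij_psi bij_is_inj bij_is_surj)
    \<comment> \<open>Codewords are counted over the field of size \<open>q ^ 2\<close>, so twice
      the dimension of \<open>C\<close> appears as the exponent of \<open>q\<close>.\<close>
    moreover have "card C = q ^ CARD('n) * q ^ k"
      unfolding card_linear_code[OF C] CARD_eq_q_square power_mult[symmetric] power_add[symmetric] k ..
    moreover have "card C * card (edual C) = q ^ CARD('n) * q ^ CARD('n)"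
      unfolding card_code_times_edual[OF C] CARD_eq_q_square power2_eq_square power_mult_distrib ..
    ultimately have "q ^ CARD('n) * (card (psi_inv emb s (hdual q C)) * q ^ k) = q ^ CARD('n) * q ^ CARD('n)"
      by (simp only: mult_ac)
    then show "card (psi_inv emb s (hdual q C)) * q ^ k = q ^ CARD('n)"
      by simp
  qed
qed

end

theorem theorem32:
  fixes r \<delta> :: nat
  assumes "r \<ge> 1" and "\<delta> \<ge> 2"
  shows
    \<comment> \<open>Hermitian case: C over F_{q^2} = 'b, quantum code over F_q = 'a\<close>
    "(\<forall>(C :: ('n::finite \<Rightarrow> 'b::{finite,field}) set) (emb :: 'a::{finite,field} \<Rightarrow> 'b) s chr k.
        CARD('b) = CARD('a) ^ 2 \<and> field_embedding emb \<and> normal_basis_elt emb s \<and>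
        linear_code C \<and> hdual CARD('a) C \<subseteq> C \<and> 2 * code_dim C = CARD('n) + k \<and>
        classical_lrc C r \<delta> \<and> stab_char (psi_inv emb s (hdual CARD('a) C)) chr \<longrightarrow>
          (let Q = stab_code (psi_inv emb s (hdual CARD('a) C)) chr in
            quantum_lrc Q r \<delta> \<and> qecc Q k (mindist C) \<and>
            int k + 2 * int (mindist C)
              + 2 * (\<lceil>real (CARD('n) + k) / real (2 * r)\<rceil> - 1) * (int \<delta> - 1)
              \<le> int CARD('n) + 2))
     \<and>
    \<comment> \<open>Euclidean case: C over F_q = 'a\<close>
     (\<forall>(C :: ('n \<Rightarrow> 'a) set) chr k.
        linear_code C \<and> edual C \<subseteq> C \<and> 2 * code_dim C = CARD('n) + k \<and>
        classical_lrc C r \<delta> \<and> stab_char (edual C \<times> edual C) chr \<longrightarrow>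
          (let Q = stab_code (edual C \<times> edual C) chr in
            quantum_lrc Q r \<delta> \<and> qecc Q k (mindist C) \<and>
            int k + 2 * int (mindist C)
              + 2 * (\<lceil>real (CARD('n) + k) / real (2 * r)\<rceil> - 1) * (int \<delta> - 1)
              \<le> int CARD('n) + 2))"
proof (intro conjI allI impI)
  fix C :: "('n \<Rightarrow> 'b) set" and emb :: "'a \<Rightarrow> 'b" and s chr k
  assume A: "CARD('b) = CARD('a) ^ 2 \<and> field_embedding emb \<and> normal_basis_elt emb s \<and>
    linear_code C \<and> hdual CARD('a) C \<subseteq> C \<and> 2 * code_dim C = CARD('n) + k \<and>
    classical_lrc C r \<delta> \<and> stab_char (psi_inv emb s (hdual CARD('a) C)) chr"
  then interpret quadratic_extension emb s "CARD('a)"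
    by unfold_locales auto
  show "let Q = stab_code (psi_inv emb s (hdual CARD('a) C)) chr in
      quantum_lrc Q r \<delta> \<and> qecc Q k (mindist C) \<and>
      int k + 2 * int (mindist C)
        + 2 * (\<lceil>real (CARD('n) + k) / real (2 * r)\<rceil> - 1) * (int \<delta> - 1) \<le> int CARD('n) + 2"
    using A hdual_lrc[of C k r \<delta> chr] lrc_singleton_bound_ceiling[of C r \<delta> k] assms
    unfolding Let_def by blast
next
  fix C :: "('n \<Rightarrow> 'a) set" and chr k
  assume A: "linear_code C \<and> edual C \<subseteq> C \<and> 2 * code_dim C = CARD('n) + k \<and>
    classical_lrc C r \<delta> \<and> stab_char (edual C \<times> edual C) chr"
  then show "let Q = stab_code (edual C \<times> edual C) chr in
      quantum_lrc Q r \<delta> \<and> qecc Q k (mindist C) \<and>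
      int k + 2 * int (mindist C)
        + 2 * (\<lceil>real (CARD('n) + k) / real (2 * r)\<rceil> - 1) * (int \<delta> - 1) \<le> int CARD('n) + 2"
    using edual_times_edual_lrc[of C k r \<delta> chr] lrc_singleton_bound_ceiling[of C r \<delta> k] assms
    unfolding Let_def by blast
qed

end
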